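(* Let $\Gamma$ be a finite, simple, connected graph with vertex set $X$, let $x\in X$ be a vertex with $|\Gamma(x)|\ge 2$, let $d$ be the eccentricity of $x$, and let $T=T(x)$ be the Terwilliger algebra of $\Gamma$ with respect to $x$. Assume that the unique irreducible $T$-module with endpoint $0$ is thin. Then the following (i) and (ii) are equivalent. (i) $\Gamma$ has, up to isomorphism, a unique irreducible $T$-module with endpoint $1$, and this module is thin. (ii) For every integer $i$ $(1\le i\le d)$ there exist scalars $\kappa_i,\mu_i,\theta_i,\rho_i\in\mathbb{C}$ such that for every $y\in\Gamma(x)$ the following (a), (b) hold: (a) For every $z\in D^i_{i+1}(x,y)\cup D^i_i(x,y)$ we have $$r^{i}\ell(y,z)=\mu_i\,\ell r^i(y,z),\qquad r^{i-1}f(y,z)=\rho_i\,\ell r^i(y,z).$$ (b) For every $z\in D^i_{i-1}(x,y)$ we have $$r^{i}\ell(y,z)=\kappa_i\,r^{i-1}(y,z)+\mu_i\,\ell r^i(y,z),\qquad r^{i-1}f(y,z)=\theta_i\,r^{i-1}(y,z)+\rho_i\,\ell r^i(y,z).$$ Moreover, $\rho_i=0$ whenever the set $D^i_{i+1}(x,y)$ is nonempty for some $y\in\Gamma(x)$.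
   Context: Let $\partial$ be the path-length distance on $\Gamma$; $\Gamma_i(x)=\{y\in X:\partial(x,y)=i\}$, $\Gamma(x)=\Gamma_1(x)$; the eccentricity of $x$ is $d=\max\{\partial(x,z):z\in X\}$. Terwilliger algebra: let $A$ be the adjacency matrix of $\Gamma$ and, for $0\le i\le d$, let $E_i^*=E_i^*(x)$ be the diagonal matrix in $\mathrm{Mat}_X(\mathbb{C})$ with $(y,y)$-entry $1$ if $\partial(x,y)=i$ and $0$ otherwise. $T=T(x)$ is the subalgebra of $\mathrm{Mat}_X(\mathbb{C})$ generated by $A,E_0^*,\dots,E_d^*$. It acts by left multiplication on the standard module $V=\mathbb{C}^X$ of column vectors. A $T$-module is a subspace $W\subseteq V$ with $TW\subseteq W$; it is irreducible if it is nonzero and contains no $T$-modules other than $0$ and $W$. The endpoint of an irreducible $T$-module $W$ is $\min\{i: E_i^*W\ne 0\}$. $W$ is thin if $\dim E_i^*W\le 1$ for all $0\le i\le d$. Two $T$-modules $W,W'$ are isomorphic if there is a vector space isomorphism $\sigma:W\to W'$ with $\sigma B=B\sigma$ on $W$ for all $B\in T$. There is always a unique irreducible $T$-module with endpoint $0$, namely $T\widehat{x}=\{B\widehat{x}:B\in T\}$, where $\widehat{x}\in V$ has a $1$ in coordinate $x$ and $0$ elsewhere. Distance sets: for $y\in\Gamma(x)$ and integers $i,j$, $D^i_j(x,y)=\Gamma_i(x)\cap\Gamma_j(y)$, where $\Gamma_j(y)=\{z:\partial(y,z)=j\}$ (empty for negative indices). Walk shapes: for a walk $[y=x_0,x_1,\dots,x_j=z]$,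 its shape with respect to $x$ is the sequence $t_1t_2\cdots t_j$ where $t_i=r$ if $\partial(x,x_i)=\partial(x,x_{i-1})+1$, $t_i=f$ if $\partial(x,x_i)=\partial(x,x_{i-1})$, and $t_i=\ell$ if $\partial(x,x_i)=\partial(x,x_{i-1})-1$. Exponents denote repetition. For $m\ge 0$, $\ell r^m(y,z)$, $r^m\ell(y,z)$, $r^mf(y,z)$ and $r^m(y,z)$ denote the number of walks from $y$ to $z$ of shape $\ell r^m$, $r^m\ell$, $r^mf$ and $r^m$ with respect to $x$, respectively (so $r^0f=f$, $\ell r^0=r^0\ell=\ell$), with $r^0(y,z)=1$ if $y=z$ and $0$ otherwise. *)

theory Defs
  imports "HOL-Analysis.Analysis"
begin

text \<open>
  A finite graph is given by its adjacency relation \<open>E\<close> on a finite type of vertices; simplicity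
  (symmetry and irreflexivity) and connectedness of \<open>E\<close> are stated as hypotheses where needed.
  The standard module is \<open>complex^'a\<close>, on which matrices in \<open>complex^'a^'a\<close> act by \<open>*v\<close>.
  The product of matrices is \<open>**\<close>, not the componentwise \<open>*\<close>; complex subspaces and dimensions are
  \<open>vec.subspace\<close> and \<open>vec.dim\<close>, not the real notions \<open>subspace\<close> and \<open>dim\<close>.
\<close>

subsection \<open>Distances\<close>

text \<open>A walk is the nonempty list of its vertices, so its length is one less than that of the list.\<close>

definition is_walk :: "('a \<Rightarrow> 'a \<Rightarrow> bool) \<Rightarrow> 'a \<Rightarrow> 'a \<Rightarrow> 'a list \<Rightarrow> bool" where
  "is_walk E u v p \<longleftrightarrow> p \<noteq> [] \<and> hd p = u \<and> last p = v \<and> successively E p"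

definition gdist :: "('a \<Rightarrow> 'a \<Rightarrow> bool) \<Rightarrow> 'a \<Rightarrow> 'a \<Rightarrow> nat" where
  "gdist E u v = (LEAST n. \<exists>p. is_walk E u v p \<and> length p = Suc n)"

definition eccentricity :: "('a::finite \<Rightarrow> 'a \<Rightarrow> bool) \<Rightarrow> 'a \<Rightarrow> nat" where
  "eccentricity E x = Max {gdist E x z | z. True}"

definition sphere_at :: "('a \<Rightarrow> 'a \<Rightarrow> bool) \<Rightarrow> nat \<Rightarrow> 'a \<Rightarrow> 'a set" where
  "sphere_at E i u = {v. gdist E u v = i}"

definition dist_set :: "('a \<Rightarrow> 'a \<Rightarrow> bool) \<Rightarrow> nat \<Rightarrow> nat \<Rightarrow> 'a \<Rightarrow> 'a \<Rightarrow> 'a set" where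
  "dist_set E i j x y = sphere_at E i x \<inter> sphere_at E j y"

subsection \<open>Walk shapes\<close>

text \<open>The letters \<open>r\<close>, \<open>f\<close> and \<open>\<ell>\<close>.\<close>

datatype step = Rise | Flat | Lower

fun is_step :: "('a \<Rightarrow> 'a \<Rightarrow> bool) \<Rightarrow> 'a \<Rightarrow> step \<Rightarrow> 'a \<Rightarrow> 'a \<Rightarrow> bool" where
  "is_step E x Rise u v \<longleftrightarrow> gdist E x v = gdist E x u + 1"
| "is_step E x Flat u v \<longleftrightarrow> gdist E x v = gdist E x u"
| "is_step E x Lower u v \<longleftrightarrow> gdist E x v + 1 = gdist E x u"

definition has_shape :: "('a \<Rightarrow> 'a \<Rightarrow> bool) \<Rightarrow> 'a \<Rightarrow> step list \<Rightarrow> 'a list \<Rightarrow> bool" where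
  "has_shape E x ts p \<longleftrightarrow>
     length p = Suc (length ts) \<and> (\<forall>i<length ts. is_step E x (ts ! i) (p ! i) (p ! Suc i))"

definition num_walks :: "('a \<Rightarrow> 'a \<Rightarrow> bool) \<Rightarrow> 'a \<Rightarrow> step list \<Rightarrow> 'a \<Rightarrow> 'a \<Rightarrow> nat" where
  "num_walks E x ts y z = card {p. is_walk E y z p \<and> has_shape E x ts p}"

definition walks_r :: "('a \<Rightarrow> 'a \<Rightarrow> bool) \<Rightarrow> 'a \<Rightarrow> nat \<Rightarrow> 'a \<Rightarrow> 'a \<Rightarrow> complex" where
  "walks_r E x m y z = of_nat (num_walks E x (replicate m Rise) y z)"

definition walks_lr :: "('a \<Rightarrow> 'a \<Rightarrow> bool) \<Rightarrow> 'a \<Rightarrow> nat \<Rightarrow> 'a \<Rightarrow> 'a \<Rightarrow> complex" where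
  "walks_lr E x m y z = of_nat (num_walks E x (Lower # replicate m Rise) y z)"

definition walks_rl :: "('a \<Rightarrow> 'a \<Rightarrow> bool) \<Rightarrow> 'a \<Rightarrow> nat \<Rightarrow> 'a \<Rightarrow> 'a \<Rightarrow> complex" where
  "walks_rl E x m y z = of_nat (num_walks E x (replicate m Rise @ [Lower]) y z)"

definition walks_rf :: "('a \<Rightarrow> 'a \<Rightarrow> bool) \<Rightarrow> 'a \<Rightarrow> nat \<Rightarrow> 'a \<Rightarrow> 'a \<Rightarrow> complex" where
  "walks_rf E x m y z = of_nat (num_walks E x (replicate m Rise @ [Flat]) y z)"

subsection \<open>The Terwilliger algebra\<close>

definition adjacency_matrix :: "('a::finite \<Rightarrow> 'a \<Rightarrow> bool) \<Rightarrow> complex^'a^'a" where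
  "adjacency_matrix E = (\<chi> u v. if E u v then 1 else 0)"

definition dual_idempotent :: "('a::finite \<Rightarrow> 'a \<Rightarrow> bool) \<Rightarrow> 'a \<Rightarrow> nat \<Rightarrow> complex^'a^'a" where
  "dual_idempotent E x i = (\<chi> y z. if y = z \<and> gdist E x y = i then 1 else 0)"

text \<open>Requiring the identity is harmless for the generated algebra below, as the dual idempotents
  sum to the identity.\<close>

definition matrix_subalgebra :: "(complex^'a::finite^'a) set \<Rightarrow> bool" where
  "matrix_subalgebra S \<longleftrightarrow>
     mat 1 \<in> S \<and>
     (\<forall>M\<in>S. \<forall>N\<in>S. M + N \<in> S) \<and>
     (\<forall>c. \<forall>M\<in>S. (\<chi> i j. c * M $ i $ j) \<in> S) \<and>
     (\<forall>M\<in>S. \<forall>N\<in>S. M ** N \<in> S)"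

definition terwilliger_algebra :: "('a::finite \<Rightarrow> 'a \<Rightarrow> bool) \<Rightarrow> 'a \<Rightarrow> (complex^'a^'a) set" where
  "terwilliger_algebra E x =
     matrix_subalgebra hull
       (insert (adjacency_matrix E) {dual_idempotent E x i | i. i \<le> eccentricity E x})"

subsection \<open>Modules\<close>

definition t_module :: "('a::finite \<Rightarrow> 'a \<Rightarrow> bool) \<Rightarrow> 'a \<Rightarrow> (complex^'a) set \<Rightarrow> bool" where
  "t_module E x W \<longleftrightarrow>
     vec.subspace W \<and> (\<forall>B\<in>terwilliger_algebra E x. \<forall>w\<in>W. B *v w \<in> W)"

definition irreducible_t_module ::
    "('a::finite \<Rightarrow> 'a \<Rightarrow> bool) \<Rightarrow> 'a \<Rightarrow> (complex^'a) set \<Rightarrow> bool" where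
  "irreducible_t_module E x W \<longleftrightarrow>
     t_module E x W \<and> W \<noteq> {0} \<and> (\<forall>U. t_module E x U \<and> U \<subseteq> W \<longrightarrow> U = {0} \<or> U = W)"

definition dual_component ::
    "('a::finite \<Rightarrow> 'a \<Rightarrow> bool) \<Rightarrow> 'a \<Rightarrow> nat \<Rightarrow> (complex^'a) set \<Rightarrow> (complex^'a) set" where
  "dual_component E x i W = (\<lambda>w. dual_idempotent E x i *v w) ` W"

definition endpoint :: "('a::finite \<Rightarrow> 'a \<Rightarrow> bool) \<Rightarrow> 'a \<Rightarrow> (complex^'a) set \<Rightarrow> nat" where
  "endpoint E x W = Min {i. i \<le> eccentricity E x \<and> dual_component E x i W \<noteq> {0}}"

definition thin :: "('a::finite \<Rightarrow> 'a \<Rightarrow> bool) \<Rightarrow> 'a \<Rightarrow> (complex^'a) set \<Rightarrow> bool" where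
  "thin E x W \<longleftrightarrow> (\<forall>i\<le>eccentricity E x. vec.dim (dual_component E x i W) \<le> 1)"

definition t_isomorphic ::
    "('a::finite \<Rightarrow> 'a \<Rightarrow> bool) \<Rightarrow> 'a \<Rightarrow> (complex^'a) set \<Rightarrow> (complex^'a) set \<Rightarrow> bool" where
  "t_isomorphic E x W W' \<longleftrightarrow>
     (\<exists>\<sigma>. bij_betw \<sigma> W W' \<and>
          (\<forall>u\<in>W. \<forall>v\<in>W. \<sigma> (u + v) = \<sigma> u + \<sigma> v) \<and>
          (\<forall>c. \<forall>u\<in>W. \<sigma> (c *s u) = c *s \<sigma> u) \<and>
          (\<forall>B\<in>terwilliger_algebra E x. \<forall>u\<in>W. \<sigma> (B *v u) = B *v \<sigma> u))"

definition primary_module :: "('a::finite \<Rightarrow> 'a \<Rightarrow> bool) \<Rightarrow> 'a \<Rightarrow> (complex^'a) set" where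
  "primary_module E x = {B *v axis x 1 | B. B \<in> terwilliger_algebra E x}"

subsection \<open>The primary module is the unique irreducible module with endpoint 0\<close>

lemma matrix_subalgebra_terwilliger: "matrix_subalgebra (terwilliger_algebra E x)"
  unfolding terwilliger_algebra_def
  by (rule hull_in) (auto simp: matrix_subalgebra_def)

lemma gdist_self: "gdist E u u = 0"
  unfolding gdist_def
  by (rule Least_equality) (auto simp: is_walk_def intro!: exI[of _ "[u]"])

lemma ex_walk:
  assumes "E\<^sup>*\<^sup>* u v"
  shows "\<exists>p. is_walk E u v p"
  using assms
proof (induction rule: converse_rtranclp_induct)
  case base
  show ?case by (auto simp: is_walk_def intro!: exI[of _ "[v]"])
next
  case (step y z)
  then obtain p where "is_walk E z v p" by blast
  with step(1) have "is_walk E y v (y # p)"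
    by (auto simp: is_walk_def successively_Cons)
  then show ?case by blast
qed

lemma gdist_eq_0_iff:
  assumes "E\<^sup>*\<^sup>* u v"
  shows "gdist E u v = 0 \<longleftrightarrow> u = v"
proof
  assume 0: "gdist E u v = 0"
  obtain p where p: "is_walk E u v p" using ex_walk[OF assms] by blast
  then have "\<exists>n p. is_walk E u v p \<and> length p = Suc n"
    by (metis is_walk_def length_greater_0_conv gr0_implies_Suc)
  then have "\<exists>p. is_walk E u v p \<and> length p = Suc (gdist E u v)"
    unfolding gdist_def by (rule LeastI_ex)
  with 0 show "u = v" by (auto simp: is_walk_def length_Suc_conv)
qed (simp add: gdist_self)

lemma adjoint_terwilliger:
  assumes "symp E" and "B \<in> terwilliger_algebra E x"
  shows "(\<chi> i j. cnj (B $ j $ i)) \<in> terwilliger_algebra E x"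
proof -
  let ?T = "terwilliger_algebra E x"
  have T: "mat 1 \<in> ?T" "\<And>M N. M \<in> ?T \<Longrightarrow> N \<in> ?T \<Longrightarrow> M + N \<in> ?T"
    "\<And>M N. M \<in> ?T \<Longrightarrow> N \<in> ?T \<Longrightarrow> M ** N \<in> ?T"
    "\<And>c M. M \<in> ?T \<Longrightarrow> (\<chi> i j. c * M $ i $ j) \<in> ?T"
    using matrix_subalgebra_terwilliger[of E x] unfolding matrix_subalgebra_def by blast+
  define Q where "Q = {M. (\<chi> i j. cnj (M $ j $ i)) \<in> ?T}"
  have gen: "M \<in> Q"
    if M: "M \<in> insert (adjacency_matrix E) {dual_idempotent E x i | i. i \<le> eccentricity E x}" for M
  proof -
    have "(\<chi> i j. cnj (M $ j $ i)) = M"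
      using M assms(1)
      by (auto simp: adjacency_matrix_def dual_idempotent_def vec_eq_iff symp_def)
    moreover have "M \<in> ?T"
      using M unfolding terwilliger_algebra_def by (rule hull_inc)
    ultimately show ?thesis by (simp add: Q_def)
  qed
  have "(\<chi> i j. cnj ((mat 1 :: complex^'a^'a) $ j $ i)) = mat 1"
    by (auto simp: mat_def vec_eq_iff)
  moreover have "(\<chi> i j. cnj ((M + N) $ j $ i)) =
      (\<chi> i j. cnj (M $ j $ i)) + (\<chi> i j. cnj (N $ j $ i))" for M N :: "complex^'a^'a"
    by (simp add: vec_eq_iff)
  moreover have "(\<chi> i j. cnj ((M ** N) $ j $ i)) =
      (\<chi> i j. cnj (N $ j $ i)) ** (\<chi> i j. cnj (M $ j $ i))" for M N :: "complex^'a^'a"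
    by (simp add: vec_eq_iff matrix_matrix_mult_def mult.commute)
  moreover have "(\<chi> i j. cnj ((\<chi> i j. c * M $ i $ j) $ j $ i)) \<in> ?T"
    if "(\<chi> i j. cnj (M $ j $ i)) \<in> ?T" for c and M :: "complex^'a^'a"
    using T(4)[OF that, of "cnj c"] by simp
  ultimately have "matrix_subalgebra Q"
    unfolding matrix_subalgebra_def Q_def mem_Collect_eq using T by simp
  with gen have "?T \<subseteq> Q"
    unfolding terwilliger_algebra_def by (intro hull_minimal subsetI)
  then show ?thesis using assms(2) by (auto simp: Q_def)
qed

lemma dual_idempotent_mult:
  "(dual_idempotent E x i *v w) $ y = (if gdist E x y = i then w $ y else 0)"
proof -
  have "(dual_idempotent E x i *v w) $ y =
      (\<Sum>z\<in>UNIV. if z = y then (if gdist E x y = i then w $ y else 0) else 0)"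
    unfolding dual_idempotent_def matrix_vector_mult_def
    by (auto intro!: sum.cong simp: if_distrib[of "\<lambda>c. c * _"] cong: if_cong)
  then show ?thesis by simp
qed

lemma dual_idempotent_0_mult:
  assumes "\<And>u v. E\<^sup>*\<^sup>* u v"
  shows "dual_idempotent E x 0 *v w = (w $ x) *s axis x 1"
  by (auto simp: vec_eq_iff dual_idempotent_mult axis_def gdist_eq_0_iff assms)

lemma t_module_contains_primary:
  assumes "\<And>u v. E\<^sup>*\<^sup>* u v" and W: "t_module E x W" and w: "w \<in> W" "w $ x \<noteq> 0"
  shows "primary_module E x \<subseteq> W"
proof -
  have "dual_idempotent E x 0 \<in> terwilliger_algebra E x"
    unfolding terwilliger_algebra_def by (auto intro!: hull_inc)
  then have "(w $ x) *s axis x 1 \<in> W"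
    using W w unfolding t_module_def by (metis dual_idempotent_0_mult[OF assms(1)])
  then have "(1 / w $ x) *s ((w $ x) *s axis x 1) \<in> W"
    using W vec.subspace_scale unfolding t_module_def by blast
  moreover have "(1 / w $ x) *s ((w $ x) *s axis x 1) = (axis x 1 :: complex^'a)"
    using w by (simp add: vec_eq_iff)
  ultimately have "axis x 1 \<in> W" by simp
  with W show ?thesis unfolding t_module_def primary_module_def by auto
qed

lemma t_module_primary: "t_module E x (primary_module E x)"
proof -
  let ?T = "terwilliger_algebra E x"
  have T: "mat 1 \<in> ?T" "\<And>M N. M \<in> ?T \<Longrightarrow> N \<in> ?T \<Longrightarrow> M + N \<in> ?T"
    "\<And>M N. M \<in> ?T \<Longrightarrow> N \<in> ?T \<Longrightarrow> M ** N \<in> ?T"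
    "\<And>c M. M \<in> ?T \<Longrightarrow> (\<chi> i j. c * M $ i $ j) \<in> ?T"
    using matrix_subalgebra_terwilliger[of E x] unfolding matrix_subalgebra_def by blast+
  have sc: "c *s (M *v v) = (\<chi> i j. c * M $ i $ j) *v v" for c and M :: "complex^'a^'a" and v
    by (simp add: vec_eq_iff matrix_vector_mult_def sum_distrib_left mult.assoc)
  have "(\<chi> i j. 0 * (mat 1 :: complex^'a^'a) $ i $ j) *v axis x 1 = 0"
    by (simp add: vec_eq_iff matrix_vector_mult_def)
  then have "0 \<in> primary_module E x"
    unfolding primary_module_def using T(4)[OF T(1), of 0] by force
  moreover have "u + v \<in> primary_module E x"
    if "u \<in> primary_module E x" "v \<in> primary_module E x" for u v
    using that T(2) unfolding primary_module_def
    by (smt (verit) matrix_vector_mult_add_rdistrib mem_Collect_eq)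
  moreover have "c *s u \<in> primary_module E x" if "u \<in> primary_module E x" for c u
    using that T(4) sc unfolding primary_module_def by blast
  moreover have "B *v u \<in> primary_module E x" if "u \<in> primary_module E x" "B \<in> ?T" for B u
    using that T(3) unfolding primary_module_def by (auto simp: matrix_vector_mul_assoc)
  ultimately show ?thesis unfolding t_module_def vec.subspace_def by blast
qed

lemma axis_mem_primary: "axis x 1 \<in> primary_module E x"
proof -
  have "mat 1 \<in> terwilliger_algebra E x"
    using matrix_subalgebra_terwilliger[of E x] unfolding matrix_subalgebra_def by blast
  then show ?thesis unfolding primary_module_def by force
qed

lemma primary_nonzero: "primary_module E x \<noteq> {0}"
proof
  assume "primary_module E x = {0}"
  with axis_mem_primary[of x E] have "axis x 1 = (0 :: complex^'a)" by blast
  then show False by (simp only: axis_eq_0_iff one_neq_zero)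
qed

lemma irreducible_primary:
  assumes "symp E" and "\<And>u v. E\<^sup>*\<^sup>* u v"
  shows "irreducible_t_module E x (primary_module E x)"
  unfolding irreducible_t_module_def
proof (intro conjI allI impI)
  show "t_module E x (primary_module E x)" by (rule t_module_primary)
  show "primary_module E x \<noteq> {0}" by (rule primary_nonzero)
  fix U assume U: "t_module E x U \<and> U \<subseteq> primary_module E x"
  show "U = {0} \<or> U = primary_module E x"
  proof (cases "\<exists>u\<in>U. u $ x \<noteq> 0")
    case True
    then obtain u where u: "u \<in> U" "u $ x \<noteq> 0" by blast
    have "primary_module E x \<subseteq> U"
      by (rule t_module_contains_primary[OF assms(2) _ u]) (use U in simp)
    then show ?thesis using U by simp
  next
    case False
    have "u = 0" if u: "u \<in> U" for u
    proof -
      obtain B where B: "B \<in> terwilliger_algebra E x" "u = B *v axis x 1"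
        using u U unfolding primary_module_def by auto
      define C where "C = (\<chi> i j. cnj (B $ j $ i))"
      have "C *v u \<in> U"
        using U u adjoint_terwilliger[OF assms(1) B(1)] unfolding t_module_def C_def by blast
      then have "(C *v u) $ x = 0" using False by blast
      moreover have ux: "u $ y = B $ y $ x" for y
        unfolding B(2) by (simp add: matrix_vector_mult_def axis_def if_distrib[of "(*) _"] cong: if_cong)
      ultimately have "(\<Sum>y\<in>UNIV. cnj (u $ y) * u $ y) = 0"
        by (simp add: C_def matrix_vector_mult_def)
      then have "of_real (\<Sum>y\<in>UNIV. (cmod (u $ y))\<^sup>2) = (0 :: complex)"
        by (simp add: complex_norm_square mult.commute del: of_real_power)
      then have "(\<Sum>y\<in>UNIV. (cmod (u $ y))\<^sup>2) = 0"
        by (simp only: of_real_eq_0_iff)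
      then show "u = 0" by (simp add: sum_nonneg_eq_0_iff vec_eq_iff)
    qed
    moreover have "0 \<in> U" using U unfolding t_module_def by (simp add: vec.subspace_0)
    ultimately show ?thesis by blast
  qed
qed

theorem irreducible_endpoint_0_iff:
  assumes "symp E" and conn: "\<And>u v. E\<^sup>*\<^sup>* u v"
  shows "irreducible_t_module E x W \<and> endpoint E x W = 0 \<longleftrightarrow> W = primary_module E x"
proof
  assume A: "irreducible_t_module E x W \<and> endpoint E x W = 0"
  let ?I = "{i. i \<le> eccentricity E x \<and> dual_component E x i W \<noteq> {0}}"
  have W: "t_module E x W" "W \<noteq> {0}" using A unfolding irreducible_t_module_def by auto
  then have "0 \<in> W" unfolding t_module_def by (simp add: vec.subspace_0)
  with W obtain w where w: "w \<in> W" "w \<noteq> 0" by blast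
  then obtain y where y: "w $ y \<noteq> 0" by (auto simp: vec_eq_iff)
  have "gdist E x y \<le> eccentricity E x"
    unfolding eccentricity_def by (rule Max_ge) (auto simp: full_SetCompr_eq)
  moreover have "(dual_idempotent E x (gdist E x y) *v w) $ y \<noteq> 0"
    using y by (simp add: dual_idempotent_mult)
  then have "dual_component E x (gdist E x y) W \<noteq> {0}"
    using w unfolding dual_component_def
    by (metis image_eqI singletonD zero_index)
  ultimately have "?I \<noteq> {}" by blast
  then have "Min ?I \<in> ?I" by (intro Min_in) auto
  then have "dual_component E x 0 W \<noteq> {0}" using A unfolding endpoint_def by auto
  moreover have "dual_component E x 0 W = {0}" if "\<forall>v\<in>W. dual_idempotent E x 0 *v v = 0"
    using that w unfolding dual_component_def by force
  ultimately obtain v where "v \<in> W" "dual_idempotent E x 0 *v v \<noteq> 0"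
    by blast
  then have "v \<in> W" "v $ x \<noteq> 0"
    by (auto simp: dual_idempotent_0_mult[OF conn])
  then have "primary_module E x \<subseteq> W" by (rule t_module_contains_primary[OF conn W(1)])
  then show "W = primary_module E x"
    using A t_module_primary[of E x] primary_nonzero[of E x]
    unfolding irreducible_t_module_def by metis
next
  assume W: "W = primary_module E x"
  have "dual_idempotent E x 0 *v axis x 1 \<in> dual_component E x 0 W"
    unfolding dual_component_def W using axis_mem_primary by blast
  moreover have "dual_idempotent E x 0 *v axis x 1 \<noteq> 0"
    by (simp add: dual_idempotent_0_mult[OF conn])
  ultimately have "dual_component E x 0 W \<noteq> {0}" by blast
  then have "endpoint E x W = 0"
    unfolding endpoint_def by (intro Min_eqI) auto
  then show "irreducible_t_module E x W \<and> endpoint E x W = 0"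
    using irreducible_primary[OF assms] W by simp
qed

subsection \<open>The walk conditions\<close>

definition walk_conditions ::
    "('a \<Rightarrow> 'a \<Rightarrow> bool) \<Rightarrow> 'a \<Rightarrow> nat \<Rightarrow> complex \<Rightarrow> complex \<Rightarrow> complex \<Rightarrow> complex \<Rightarrow> bool" where
  "walk_conditions E x i \<kappa> \<mu> \<theta> \<rho> \<longleftrightarrow>
     (\<forall>y\<in>sphere_at E 1 x.
        (\<forall>z\<in>dist_set E i (i + 1) x y \<union> dist_set E i i x y.
           walks_rl E x i y z = \<mu> * walks_lr E x i y z \<and>
           walks_rf E x (i - 1) y z = \<rho> * walks_lr E x i y z) \<and>
        (\<forall>z\<in>dist_set E i (i - 1) x y.
           walks_rl E x i y z = \<kappa> * walks_r E x (i - 1) y z + \<mu> * walks_lr E x i y z \<and>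
           walks_rf E x (i - 1) y z = \<theta> * walks_r E x (i - 1) y z + \<rho> * walks_lr E x i y z))"

end

theory Submission
  imports Defs
begin

text \<open>
  Split the adjacency matrix as \<open>A = R + F + L\<close>, where \<open>R\<close>, \<open>F\<close> and \<open>L\<close> keep the edges along which
  the distance to \<open>x\<close> rises by one, is constant, or drops by one.  All three lie in the Terwilliger
  algebra \<open>T\<close>, and products of them count walks of a given shape: \<open>(L R\<^sup>i)\<^sub>z\<^sub>y\<close> is the number
  of walks from \<open>y\<close> to \<open>z\<close> of shape \<open>r\<^sup>i\<ell>\<close>, and so on.

  Let \<open>U\<close> consist of the vectors supported on \<open>\<Gamma>(x)\<close> whose coordinates sum to zero; equivalently,
  those with \<open>L v = 0\<close>.  Every irreducible module with endpoint 1 has a nonzero vector in \<open>U\<close>.  Both (i) and (ii) turn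
  out to be equivalent to the following statement (*): there are scalars \<open>\<kappa>\<^sub>j, \<theta>\<^sub>j\<close> such that for
  all \<open>v \<in> U\<close> and all \<open>j\<close>
  \<open>L R\<^bsup>j+1\<^esup> v = \<kappa>\<^sub>j R\<^sup>j v\<close> and \<open>F R\<^sup>j v = \<theta>\<^sub>j R\<^sup>j v\<close>.
  A vector with these properties is called a ladder below.

  (ii) and (*).  For \<open>y \<in> \<Gamma>(x)\<close>, a walk of shape \<open>\<ell>r\<^sup>i\<close> from \<open>y\<close> to \<open>z\<close> first drops to \<open>x\<close>.  So
  \<open>\<ell>r\<^sup>i(y,z)\<close> is a number \<open>s\<^sub>i(z)\<close> independent of \<open>y\<close>, and the functions \<open>s\<^sub>i = R\<^sup>i x\<close> live in the
  primary module.  As \<open>r\<^bsup>i-1\<^esup>(y,z)\<close> vanishes for \<open>z \<in> \<Gamma>\<^sub>i(x)\<close> unless \<open>\<partial>(y,z) = i - 1\<close>, both parts of (ii) say that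
  \<open>L R\<^sup>i = \<kappa> R\<^bsup>i-1\<^esup> + \<mu> R\<^sup>i L\<close> and \<open>F R\<^bsup>i-1\<^esup> = \<theta> R\<^bsup>i-1\<^esup> + \<rho> R\<^sup>i L\<close> on vectors supported on
  \<open>\<Gamma>(x)\<close> (lemma \<open>walk_conditions_iff\<close>).  Restricting to \<open>U\<close> kills the terms with \<open>\<mu>\<close> and \<open>\<rho>\<close> and gives
  (*).  Conversely, vectors on \<open>\<Gamma>(x)\<close> are spanned by \<open>U\<close> and \<open>s\<^sub>1\<close>; thinness of the primary module
  makes \<open>L s\<^bsub>i+1\<^esub>\<close> and \<open>F s\<^sub>i\<close> multiples of \<open>s\<^sub>i\<close>, and \<open>\<mu>\<close> and \<open>\<rho>\<close> are chosen so that the two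
  identities hold on \<open>s\<^sub>1\<close> as well (lemma \<open>ladder_imp_walk_conditions\<close>).

  (*) implies (i).  For a ladder \<open>v\<close> the module \<open>T v\<close> is spanned by the \<open>R\<^sup>j v\<close>, and the coefficients
  with which an element of \<open>T\<close> acts on these depend only on \<open>\<kappa>\<close> and \<open>\<theta>\<close>
  (lemma \<open>terwilliger_in_ladder_span\<close>).  Hence \<open>T v\<close> is thin; it is irreducible because \<open>T\<close> is closed
  under adjoints; and two ladders with the same scalars generate isomorphic modules because
  \<open>\<parallel>B v\<parallel>\<^sup>2 = \<langle>v, B\<^sup>* B v\<rangle>\<close> is the same multiple of \<open>\<parallel>v\<parallel>\<^sup>2\<close> for all of them
  (lemma \<open>cyclic_ladder_isomorphic\<close>).

  (i) implies (*).  In a thin module each \<open>R\<^sup>j w\<close> with \<open>w \<in> U\<close> spans its level or is zero, so \<open>w\<close> is a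
  ladder; an isomorphism carries the scalars over, so the vectors that irreducible modules
  with endpoint 1 have on \<open>\<Gamma>(x)\<close> are ladders with common scalars.  If these ladders did not fill \<open>U\<close>,
  a nonzero \<open>u \<in> U\<close> orthogonal to all of them would generate a module containing an irreducible one
  with endpoint 1, whose vectors on \<open>\<Gamma>(x)\<close> would be orthogonal to themselves
  (lemma \<open>unique_thin_imp_ladder\<close>).

  Finally, if \<open>\<partial>(y,z) = i + 1\<close> then no walk of length \<open>i\<close> joins \<open>y\<close> to \<open>z\<close>, while \<open>s\<^sub>i(z) \<noteq> 0\<close>;
  hence \<open>\<rho>\<^sub>i = 0\<close>.
\<close>

section \<open>Distances in a connected graph\<close>

lemma gdist_le_walk:
  assumes "is_walk E u v p" shows "gdist E u v \<le> length p - 1"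
  unfolding gdist_def
  by (rule Least_le) (use assms in \<open>auto simp: is_walk_def intro!: exI[of _ p]\<close>)

lemma is_walk_snoc:
  assumes "is_walk E u v p" "E v w" shows "is_walk E u w (p @ [w])"
  using assms by (auto simp: is_walk_def successively_append_iff)

lemma is_walk_Cons:
  "is_walk E u w (v # q) \<longleftrightarrow> v = u \<and> (if q = [] then v = w else E v (hd q) \<and> is_walk E (hd q) w q)"
  by (auto simp: is_walk_def successively_Cons)

locale connected_graph =
  fixes E :: "'a::finite \<Rightarrow> 'a \<Rightarrow> bool"
  assumes sym: "symp E" and conn: "\<And>u v. E\<^sup>*\<^sup>* u v"
begin

lemma shortest_walk:
  obtains p where "is_walk E u v p" "length p = Suc (gdist E u v)"
proof -
  obtain p where p: "is_walk E u v p" using ex_walk conn by metis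
  then have "\<exists>n p. is_walk E u v p \<and> length p = Suc n"
    by (metis is_walk_def length_greater_0_conv gr0_implies_Suc)
  then have "\<exists>p. is_walk E u v p \<and> length p = Suc (gdist E u v)"
    unfolding gdist_def by (rule LeastI_ex)
  with that show thesis by blast
qed

lemma gdist_step_right:
  assumes "E v w" shows "gdist E u w \<le> Suc (gdist E u v)"
proof -
  obtain p where p: "is_walk E u v p" "length p = Suc (gdist E u v)" by (rule shortest_walk)
  from gdist_le_walk[OF is_walk_snoc[OF p(1) assms]] p(2) show ?thesis by simp
qed

lemma gdist_step_left:
  assumes "E u v" shows "gdist E u w \<le> Suc (gdist E v w)"
proof -
  obtain p where p: "is_walk E v w p" "length p = Suc (gdist E v w)" by (rule shortest_walk)
  then have "is_walk E u w (u # p)"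
    using assms by (auto simp: is_walk_def successively_Cons)
  from gdist_le_walk[OF this] p(2) show ?thesis by simp
qed

lemma gdist_Suc_pred:
  assumes "gdist E u w = Suc i"
  obtains v where "E v w" "gdist E u v = i"
proof -
  obtain p where p: "is_walk E u w p" "length p = Suc (gdist E u w)" by (rule shortest_walk)
  define q where "q = butlast p"
  have q: "length q = Suc i" "p = q @ [w]" "q \<noteq> []"
    using p assms unfolding q_def by (auto simp: is_walk_def simp flip: length_0_conv)
  then have walk: "is_walk E u (last q) q" and step: "E (last q) w"
    using p(1) by (auto simp: is_walk_def successively_append_iff)
  have "gdist E u (last q) = i"
    using gdist_le_walk[OF walk] gdist_step_right[OF step, of u] q(1) assms by simp
  with step that show thesis by blast
qed

lemma gdist_eq_1_imp_edge: "gdist E u v = 1 \<Longrightarrow> E u v"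
  by (metis One_nat_def conn gdist_Suc_pred gdist_eq_0_iff)

end

section \<open>Walk counts as matrix entries\<close>

text \<open>
  For the three step types these are the raising, flat and lowering parts \<open>R\<close>, \<open>F\<close>, \<open>L\<close> of the
  adjacency matrix.  Since matrices act on column vectors, the column index is the start of the step
  and the row index its end.
\<close>

definition step_matrix :: "('a::finite \<Rightarrow> 'a \<Rightarrow> bool) \<Rightarrow> 'a \<Rightarrow> step \<Rightarrow> complex^'a^'a" where
  "step_matrix E x t = (\<chi> z y. if E y z \<and> is_step E x t y z then 1 else 0)"

text \<open>
  Matrices act from the left, so the first step of a walk is the rightmost factor.
\<close>

fun walk_matrix :: "('a::finite \<Rightarrow> 'a \<Rightarrow> bool) \<Rightarrow> 'a \<Rightarrow> step list \<Rightarrow> complex^'a^'a" where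
  "walk_matrix E x [] = mat 1"
| "walk_matrix E x (t # ts) = walk_matrix E x ts ** step_matrix E x t"

definition raise_power :: "('a::finite \<Rightarrow> 'a \<Rightarrow> bool) \<Rightarrow> 'a \<Rightarrow> nat \<Rightarrow> complex^'a^'a" where
  "raise_power E x m = walk_matrix E x (replicate m Rise)"

lemma walk_matrix_append: "walk_matrix E x (ts @ us) = walk_matrix E x us ** walk_matrix E x ts"
  by (induction ts) (auto simp: matrix_mul_assoc)

lemma raise_power_0 [simp]: "raise_power E x 0 = mat 1"
  by (simp add: raise_power_def)

lemma raise_power_Suc:
  "raise_power E x (Suc m) *v v = step_matrix E x Rise *v (raise_power E x m *v v)"
proof -
  have "raise_power E x (Suc m) = walk_matrix E x (replicate m Rise @ [Rise])"
    by (simp add: raise_power_def replicate_append_same del: walk_matrix.simps)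
  also have "\<dots> = step_matrix E x Rise ** raise_power E x m"
    by (simp add: walk_matrix_append raise_power_def)
  finally show ?thesis by (simp add: matrix_vector_mul_assoc)
qed

lemma finite_shaped_walks: "finite {p. is_walk E y z p \<and> has_shape E x ts (p :: 'a::finite list)}"
  by (rule finite_subset[OF _ finite_list_length[of "Suc (length ts)"]])
    (auto simp: has_shape_def)

lemma num_walks_nonzero_iff:
  fixes E :: "'a::finite \<Rightarrow> 'a \<Rightarrow> bool"
  shows "num_walks E x ts y z \<noteq> 0 \<longleftrightarrow> (\<exists>p. is_walk E y z p \<and> has_shape E x ts p)"
  unfolding num_walks_def using finite_shaped_walks[of E y z x ts] by auto

lemma has_shape_Cons:
  assumes "q \<noteq> []"
  shows "has_shape E x (t # ts) (u # q) \<longleftrightarrow> is_step E x t u (hd q) \<and> has_shape E x ts q"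
  using assms by (auto simp: has_shape_def All_less_Suc2 hd_conv_nth)

lemma num_walks_Cons:
  fixes E :: "'a::finite \<Rightarrow> 'a \<Rightarrow> bool"
  shows "num_walks E x (t # ts) y z =
     (\<Sum>w\<in>{w. E y w \<and> is_step E x t y w}. num_walks E x ts w z)"
proof -
  let ?P = "\<lambda>w. {q. is_walk E w z q \<and> has_shape E x ts q}"
  let ?S = "{w. E y w \<and> is_step E x t y w}"
  have "p \<in> Cons y ` (\<Union>w\<in>?S. ?P w)" if p: "is_walk E y z p" "has_shape E x (t # ts) p" for p
  proof -
    define q where "q = tl p"
    have q: "p = y # q" "q \<noteq> []"
      using p unfolding q_def
      by (auto simp: is_walk_def has_shape_def neq_Nil_conv length_Suc_conv)
    then have "hd q \<in> ?S" "q \<in> ?P (hd q)"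
      using p has_shape_Cons[of q E x t ts y] is_walk_Cons[of E y z y q] by auto
    with q show ?thesis by blast
  qed
  moreover have "is_walk E y z (y # q) \<and> has_shape E x (t # ts) (y # q)"
    if "w \<in> ?S" "q \<in> ?P w" for w q
  proof -
    have "q \<noteq> []" "hd q = w" using that by (auto simp: is_walk_def)
    with that show ?thesis
      using has_shape_Cons[of q E x t ts y] is_walk_Cons[of E y z y q] by auto
  qed
  ultimately have "{p. is_walk E y z p \<and> has_shape E x (t # ts) p} = Cons y ` (\<Union>w\<in>?S. ?P w)"
    by blast
  then have "num_walks E x (t # ts) y z = card (\<Union>w\<in>?S. ?P w)"
    unfolding num_walks_def by (simp add: card_image)
  also have "\<dots> = (\<Sum>w\<in>?S. card (?P w))"
    by (rule card_UN_disjoint) (simp_all add: finite_shaped_walks, auto simp: is_walk_def)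
  finally show ?thesis by (simp add: num_walks_def)
qed

lemma num_walks_Nil: "num_walks E x [] y z = (if y = z then 1 else 0)"
proof -
  have "{p. is_walk E y z p \<and> has_shape E x [] p} = (if y = z then {[y]} else {})"
    by (auto simp: is_walk_def has_shape_def length_Suc_conv)
  then show ?thesis by (simp add: num_walks_def)
qed

lemma walk_matrix_entry: "walk_matrix E x ts $ z $ y = of_nat (num_walks E x ts y z)"
proof (induction ts arbitrary: y)
  case Nil
  then show ?case by (auto simp: num_walks_Nil mat_def)
next
  case (Cons t ts)
  have "walk_matrix E x (t # ts) $ z $ y =
      (\<Sum>w\<in>UNIV. if E y w \<and> is_step E x t y w then of_nat (num_walks E x ts w z) else 0)"
    by (auto simp: matrix_matrix_mult_def step_matrix_def Cons.IH intro!: sum.cong)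
  also have "\<dots> = (\<Sum>w\<in>{w. E y w \<and> is_step E x t y w}. of_nat (num_walks E x ts w z))"
    by (simp add: sum.If_cases)
  finally show ?case by (simp add: num_walks_Cons)
qed

lemma gdist_le_num_walks:
  fixes E :: "'a::finite \<Rightarrow> 'a \<Rightarrow> bool"
  assumes "num_walks E x ts y z \<noteq> 0" shows "gdist E y z \<le> length ts"
proof -
  obtain p where p: "is_walk E y z p" "has_shape E x ts p"
    using assms num_walks_nonzero_iff[of E x ts y z] by blast
  from gdist_le_walk[OF p(1)] p(2) show ?thesis by (simp add: has_shape_def)
qed

context connected_graph
begin

text \<open>
  A geodesic from \<open>x\<close> rises at every step.
\<close>

lemma ascending_walk_exists: "num_walks E x (replicate (gdist E x z) Rise) x z \<noteq> 0"
proof -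
  have "\<exists>p. is_walk E x z p \<and> has_shape E x (replicate i Rise) p" if "gdist E x z = i" for i
    using that
  proof (induction i arbitrary: z)
    case 0
    then have "z = x" using gdist_eq_0_iff[of E x z] conn by auto
    then show ?case by (auto simp: is_walk_def has_shape_def intro!: exI[of _ "[x]"])
  next
    case (Suc i)
    obtain w where w: "E w z" "gdist E x w = i" using gdist_Suc_pred[OF Suc.prems] by blast
    then obtain p where p: "is_walk E x w p" "has_shape E x (replicate i Rise) p"
      using Suc.IH by blast
    have "length p = Suc i" and "p ! i = w"
      using p by (auto simp: has_shape_def is_walk_def last_conv_nth)
    then have "has_shape E x (replicate (Suc i) Rise) (p @ [z])"
      using p(2) w(2) Suc.prems
      by (auto simp: has_shape_def nth_append less_Suc_eq simp del: replicate_Suc)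
    with is_walk_snoc[OF p(1) w(1)] show ?case by blast
  qed
  then show ?thesis using num_walks_nonzero_iff[of E x "replicate (gdist E x z) Rise" x z] by blast
qed

end

section \<open>Adjoints and one-dimensional spaces\<close>

lemma scaled_matrix_mult:
  fixes M :: "complex^'a::finite^'a"
  shows "(\<chi> i j. c * M $ i $ j) *v v = c *s (M *v v)"
  by (simp add: vec_eq_iff matrix_vector_mult_def sum_distrib_left mult.assoc)

text \<open>
  Orthogonality is taken with respect to the real inner product on \<open>complex^'n\<close>, which is the real
  part of the Hermitian one.  For complex subspaces both give the same orthogonal complement,
  and conjugate transposition is adjunction for both.
\<close>

lemma inner_adjoint:
  fixes B :: "complex^'b::finite^'b"
  shows "(B *v u) \<bullet> w = u \<bullet> ((\<chi> i j. cnj (B $ j $ i)) *v w)"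
proof -
  have inner_Re: "a \<bullet> b = Re (\<Sum>i\<in>UNIV. a $ i * cnj (b $ i))" for a b :: "complex^'b"
    by (simp add: inner_vec_def inner_complex_def)
  have "(\<Sum>i\<in>UNIV. (B *v u) $ i * cnj (w $ i)) = (\<Sum>i\<in>UNIV. \<Sum>j\<in>UNIV. B $ i $ j * u $ j * cnj (w $ i))"
    by (simp add: matrix_vector_mult_def sum_distrib_right)
  also have "\<dots> = (\<Sum>j\<in>UNIV. \<Sum>i\<in>UNIV. B $ i $ j * u $ j * cnj (w $ i))"
    by (rule sum.swap)
  also have "\<dots> = (\<Sum>j\<in>UNIV. u $ j * cnj (((\<chi> i j. cnj (B $ j $ i)) *v w) $ j))"
    by (simp add: matrix_vector_mult_def sum_distrib_left mult_ac)
  finally show ?thesis by (simp only: inner_Re)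
qed

lemma inner_dual_idempotent:
  "(dual_idempotent E x i *v u) \<bullet> w = u \<bullet> (dual_idempotent E x i *v w)"
  unfolding inner_vec_def dual_idempotent_mult by (rule sum.cong) auto

lemma inner_scale_left:
  fixes u w :: "complex^'b::finite"
  shows "(c *s u) \<bullet> w = u \<bullet> (cnj c *s w)"
  by (simp add: inner_vec_def inner_complex_def algebra_simps)

lemma proportional_if_dim_le_1:
  assumes "vec.dim S \<le> 1" "a \<in> S" "a \<noteq> 0" "b \<in> (S :: ('k::field^'b) set)"
  obtains c where "b = c *s a"
proof -
  have "b \<in> vec.span {a}"
  proof (rule ccontr)
    assume b: "b \<notin> vec.span {a}"
    then have "b \<noteq> a" using vec.span_base by blast
    have "vec.independent {a}"
      using assms(3) vec.independent_insert[of a "{}"] vec.independent_empty by simp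
    then have "vec.independent {b, a}"
      using vec.independent_insert[of b "{a}"] b \<open>b \<noteq> a\<close> by simp
    then have "card {b, a} \<le> vec.dim S"
      using assms by (intro vec.independent_card_le_dim) auto
    with \<open>b \<noteq> a\<close> assms(1) show False by simp
  qed
  then show thesis using that by (auto simp: vec.span_singleton)
qed

lemma dim_le_1_if_proportional:
  assumes "\<And>b. b \<in> S \<Longrightarrow> \<exists>c. b = c *s (a :: 'k::field^'b)"
  shows "vec.dim S \<le> 1"
proof -
  have "S \<subseteq> vec.span {a}" using assms by (auto simp: vec.span_singleton)
  then have "vec.dim S \<le> card {a}" by (intro vec.dim_le_card) auto
  then show ?thesis by simp
qed

section \<open>The Terwilliger algebra in terms of steps\<close>

text \<open>
  Membership in the range of the \<open>i\<close>-th dual idempotent.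
\<close>

definition at_level :: "('a::finite \<Rightarrow> 'a \<Rightarrow> bool) \<Rightarrow> 'a \<Rightarrow> nat \<Rightarrow> complex^'a \<Rightarrow> bool" where
  "at_level E x i v \<longleftrightarrow> (\<forall>y. gdist E x y \<noteq> i \<longrightarrow> v $ y = 0)"

lemma
  shows terwilliger_one: "mat 1 \<in> terwilliger_algebra E x"
    and terwilliger_add: "M \<in> terwilliger_algebra E x \<Longrightarrow> N \<in> terwilliger_algebra E x \<Longrightarrow>
      M + N \<in> terwilliger_algebra E x"
    and terwilliger_scale: "M \<in> terwilliger_algebra E x \<Longrightarrow>
      (\<chi> i j. c * M $ i $ j) \<in> terwilliger_algebra E x"
    and terwilliger_mult: "M \<in> terwilliger_algebra E x \<Longrightarrow> N \<in> terwilliger_algebra E x \<Longrightarrow>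
      M ** N \<in> terwilliger_algebra E x"
  using matrix_subalgebra_terwilliger[of E x] unfolding matrix_subalgebra_def by blast+

lemma terwilliger_diff:
  assumes "M \<in> terwilliger_algebra E x" "N \<in> terwilliger_algebra E x"
  shows "M - N \<in> terwilliger_algebra E x"
proof -
  have "M - N = M + (\<chi> i j. (- 1) * N $ i $ j)" by (simp add: vec_eq_iff)
  then show ?thesis using assms by (metis terwilliger_add terwilliger_scale)
qed

lemma terwilliger_zero: "0 \<in> terwilliger_algebra E x"
  using terwilliger_diff[OF terwilliger_one terwilliger_one] by simp

lemma terwilliger_sum:
  assumes "\<And>i. i \<in> I \<Longrightarrow> M i \<in> terwilliger_algebra E x"
  shows "sum M I \<in> terwilliger_algebra E x"
  using assms by (induction I rule: infinite_finite_induct) (auto simp: terwilliger_zero terwilliger_add)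

lemma adjacency_in_terwilliger: "adjacency_matrix E \<in> terwilliger_algebra E x"
  unfolding terwilliger_algebra_def by (rule hull_inc) simp

lemma gdist_le_eccentricity: "gdist E x y \<le> eccentricity E x"
  unfolding eccentricity_def by (rule Max_ge) (auto simp: full_SetCompr_eq)

lemma dual_idempotent_in_terwilliger: "dual_idempotent E x i \<in> terwilliger_algebra E x"
proof (cases "i \<le> eccentricity E x")
  case True
  then show ?thesis unfolding terwilliger_algebra_def by (auto intro!: hull_inc)
next
  case False
  then have "dual_idempotent E x i = 0"
    using gdist_le_eccentricity[of E x] by (auto simp: dual_idempotent_def vec_eq_iff)
  then show ?thesis by (simp add: terwilliger_zero)
qed

lemma dual_idempotent_conjugate_entry:
  "(dual_idempotent E x j ** M ** dual_idempotent E x i) $ z $ y =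
     (if gdist E x z = j \<and> gdist E x y = i then M $ z $ y else 0)"
proof -
  have 1: "(dual_idempotent E x j ** M) $ z $ w = (if gdist E x z = j then M $ z $ w else 0)" for w
  proof -
    have "(dual_idempotent E x j ** M) $ z $ w =
        (\<Sum>k\<in>UNIV. if k = z then (if gdist E x z = j then M $ z $ w else 0) else 0)"
      unfolding matrix_matrix_mult_def vec_lambda_beta
      by (rule sum.cong) (auto simp: dual_idempotent_def)
    then show ?thesis by simp
  qed
  have "(dual_idempotent E x j ** M ** dual_idempotent E x i) $ z $ y =
      (\<Sum>k\<in>UNIV. (dual_idempotent E x j ** M) $ z $ k * dual_idempotent E x i $ k $ y)"
    by (simp add: matrix_matrix_mult_def)
  also have "\<dots> =
      (\<Sum>k\<in>UNIV. if k = y then (if gdist E x z = j \<and> gdist E x y = i then M $ z $ y else 0) else 0)"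
    unfolding 1 by (rule sum.cong) (auto simp: dual_idempotent_def)
  finally show ?thesis by simp
qed

lemma dual_idempotent_level:
  assumes "at_level E x i v"
  shows "dual_idempotent E x k *v v = (if k = i then v else 0)"
  using assms by (auto simp: vec_eq_iff dual_idempotent_mult at_level_def)

lemma at_level_dual_idempotent: "at_level E x i (dual_idempotent E x i *v v)"
  by (auto simp: at_level_def dual_idempotent_mult)

lemma at_level_imp_zero: "at_level E x i v \<Longrightarrow> eccentricity E x < i \<Longrightarrow> v = 0"
  using gdist_le_eccentricity[of E x] by (auto simp: at_level_def vec_eq_iff) (metis not_le)

lemma at_level_zero: "at_level E x i 0"
  and at_level_add: "at_level E x i u \<Longrightarrow> at_level E x i v \<Longrightarrow> at_level E x i (u + v)"
  and at_level_diff: "at_level E x i u \<Longrightarrow> at_level E x i v \<Longrightarrow> at_level E x i (u - v)"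
  and at_level_scale: "at_level E x i u \<Longrightarrow> at_level E x i (c *s u)"
  by (auto simp: at_level_def)

lemma step_matrix_mult_nonzero:
  assumes "(step_matrix E x t *v v) $ z \<noteq> 0"
  obtains y where "v $ y \<noteq> 0" "is_step E x t y z"
proof -
  obtain y where "step_matrix E x t $ z $ y * v $ y \<noteq> 0"
    using assms sum.not_neutral_contains_not_neutral
    by (metis (no_types, lifting) matrix_vector_mult_def vec_lambda_beta)
  with that show thesis by (auto simp: step_matrix_def split: if_splits)
qed

lemma at_level_rise: "at_level E x i v \<Longrightarrow> at_level E x (Suc i) (step_matrix E x Rise *v v)"
  unfolding at_level_def by (metis step_matrix_mult_nonzero is_step.simps(1) Suc_eq_plus1)

lemma at_level_flat: "at_level E x i v \<Longrightarrow> at_level E x i (step_matrix E x Flat *v v)"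
  unfolding at_level_def by (metis step_matrix_mult_nonzero is_step.simps(2))

lemma at_level_lower: "at_level E x (Suc i) v \<Longrightarrow> at_level E x i (step_matrix E x Lower *v v)"
  unfolding at_level_def
  by (metis step_matrix_mult_nonzero is_step.simps(3) Suc_eq_plus1 add_right_imp_eq)

lemma at_level_raise_power: "at_level E x i v \<Longrightarrow> at_level E x (i + m) (raise_power E x m *v v)"
proof (induction m)
  case (Suc m)
  then show ?case using at_level_rise[of E x "i + m"] by (simp only: raise_power_Suc) simp
qed simp

context connected_graph
begin

text \<open>
  Sandwiching the adjacency matrix between two dual idempotents keeps the edges from one level to
  another; a step matrix is a sum of such blocks.
\<close>

lemma step_matrix_in_terwilliger: "step_matrix E x t \<in> terwilliger_algebra E x"
proof -
  let ?d = "eccentricity E x"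
  define rel where "rel i j = (case t of Rise \<Rightarrow> j = i + 1 | Flat \<Rightarrow> j = i | Lower \<Rightarrow> j + 1 = i)"
    for i j :: nat
  define I where "I = {(i, j). i \<le> ?d \<and> j \<le> ?d \<and> rel i j}"
  have fin: "finite I"
    by (rule finite_subset[of _ "{..?d} \<times> {..?d}"]) (auto simp: I_def)
  let ?M = "\<lambda>(i, j). dual_idempotent E x j ** adjacency_matrix E ** dual_idempotent E x i"
  have "step_matrix E x t $ z $ y = sum ?M I $ z $ y" for y z
  proof -
    have "sum ?M I $ z $ y =
        (\<Sum>p\<in>I. if p = (gdist E x y, gdist E x z) then adjacency_matrix E $ z $ y else 0)"
      unfolding sum_component
      by (rule sum.cong) (auto simp: dual_idempotent_conjugate_entry split: prod.splits)
    also have "\<dots> = (if rel (gdist E x y) (gdist E x z) then adjacency_matrix E $ z $ y else 0)"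
      using fin gdist_le_eccentricity[of E x] by (simp add: I_def)
    also have "\<dots> = step_matrix E x t $ z $ y"
      using sym by (cases t) (auto simp: step_matrix_def rel_def adjacency_matrix_def symp_def)
    finally show ?thesis by simp
  qed
  then have "step_matrix E x t = sum ?M I" by (simp add: vec_eq_iff)
  moreover have "sum ?M I \<in> terwilliger_algebra E x"
    by (intro terwilliger_sum)
      (auto intro!: terwilliger_mult dual_idempotent_in_terwilliger adjacency_in_terwilliger)
  ultimately show ?thesis by simp
qed

lemma walk_matrix_in_terwilliger: "walk_matrix E x ts \<in> terwilliger_algebra E x"
  by (induction ts) (auto intro: terwilliger_one terwilliger_mult step_matrix_in_terwilliger)

text \<open>
  Adjacent vertices have distances to \<open>x\<close> that differ by at most one.
\<close>

lemma adjacency_step_decomposition: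
  "adjacency_matrix E = step_matrix E x Rise + step_matrix E x Flat + step_matrix E x Lower"
proof -
  have "gdist E x v = gdist E x u + 1 \<or> gdist E x v = gdist E x u \<or> gdist E x v + 1 = gdist E x u"
    if "E u v" for u v
    using gdist_step_right[of u v x] gdist_step_right[of v u x] that sym
    by (auto simp: symp_def)
  with sym show ?thesis
    by (fastforce simp: vec_eq_iff adjacency_matrix_def step_matrix_def symp_def)
qed

end

section \<open>Ladder vectors\<close>

locale rooted_graph = connected_graph E for E :: "'a::finite \<Rightarrow> 'a \<Rightarrow> bool" +
  fixes x :: 'a
begin

abbreviation T where "T \<equiv> terwilliger_algebra E x"
abbreviation proj where "proj i v \<equiv> dual_idempotent E x i *v v"
abbreviation raise where "raise m v \<equiv> raise_power E x m *v v"
abbreviation flat where "flat v \<equiv> step_matrix E x Flat *v v"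
abbreviation lower where "lower v \<equiv> step_matrix E x Lower *v v"
abbreviation level where "level i v \<equiv> at_level E x i v"
abbreviation ecc where "ecc \<equiv> eccentricity E x"
abbreviation adjoint_matrix :: "complex^'a^'a \<Rightarrow> complex^'a^'a" where
  "adjoint_matrix B \<equiv> (\<chi> i j. cnj (B $ j $ i))"

text \<open>
  The eigenvalue-like scalars are parameters of the notion because all that follows depends on
  several vectors sharing them.  For vectors supported on \<open>\<Gamma>(x)\<close>, the condition that the lowering
  part vanishes says that the coordinates sum to zero.
\<close>

definition ladder :: "(nat \<Rightarrow> complex) \<Rightarrow> (nat \<Rightarrow> complex) \<Rightarrow> complex^'a \<Rightarrow> bool" where
  "ladder \<kappa> \<theta> v \<longleftrightarrow> level 1 v \<and> lower v = 0 \<and>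
     (\<forall>j. lower (raise (Suc j) v) = \<kappa> j *s raise j v \<and> flat (raise j v) = \<theta> j *s raise j v)"

text \<open>
  The coefficients \<open>c\<close> are chosen before the vector \<open>v\<close>: on all ladders with the same scalars, \<open>f\<close> is
  one and the same combination of the operators \<open>R\<^sup>i\<close>.  This uniformity is what makes the modules
  of different ladders isomorphic.
\<close>

definition in_ladder_span ::
    "(nat \<Rightarrow> complex) \<Rightarrow> (nat \<Rightarrow> complex) \<Rightarrow> (complex^'a \<Rightarrow> complex^'a) \<Rightarrow> bool" where
  "in_ladder_span \<kappa> \<theta> f \<longleftrightarrow>
     (\<exists>c. \<forall>v. ladder \<kappa> \<theta> v \<longrightarrow> f v = (\<Sum>i\<le>ecc. c i *s raise i v))"

lemma level_raise_ladder: "ladder \<kappa> \<theta> v \<Longrightarrow> level (Suc i) (raise i v)"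
  using at_level_raise_power[of E x 1 v i] by (simp add: ladder_def)

lemma in_ladder_span_raise: "in_ladder_span \<kappa> \<theta> (raise j)"
proof (cases "j \<le> ecc")
  case True
  have "raise j v = (\<Sum>i\<le>ecc. (if i = j then 1 else 0) *s raise i v)" for v
  proof -
    have "(\<Sum>i\<le>ecc. (if i = j then 1 else 0) *s raise i v) = (\<Sum>i\<le>ecc. if i = j then raise j v else 0)"
      by (rule sum.cong) auto
    with True show ?thesis by simp
  qed
  then show ?thesis
    unfolding in_ladder_span_def by (intro exI[of _ "\<lambda>i. if i = j then 1 else 0"]) blast
next
  case False
  then have "ladder \<kappa> \<theta> v \<Longrightarrow> raise j v = (\<Sum>i\<le>ecc. 0 *s raise i v)" for v
    using at_level_imp_zero[OF level_raise_ladder, of \<kappa> \<theta> v j] by simp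
  then show ?thesis unfolding in_ladder_span_def by (intro exI[of _ "\<lambda>i. 0"]) blast
qed

lemma in_ladder_span_cong:
  assumes "in_ladder_span \<kappa> \<theta> f" "\<And>v. ladder \<kappa> \<theta> v \<Longrightarrow> g v = f v"
  shows "in_ladder_span \<kappa> \<theta> g"
  using assms unfolding in_ladder_span_def by metis

lemma in_ladder_span_add:
  assumes "in_ladder_span \<kappa> \<theta> f" "in_ladder_span \<kappa> \<theta> g"
  shows "in_ladder_span \<kappa> \<theta> (\<lambda>v. f v + g v)"
proof -
  obtain b where b: "\<And>v. ladder \<kappa> \<theta> v \<Longrightarrow> f v = (\<Sum>i\<le>ecc. b i *s raise i v)"
    using assms(1) unfolding in_ladder_span_def by auto
  obtain c where c: "\<And>v. ladder \<kappa> \<theta> v \<Longrightarrow> g v = (\<Sum>i\<le>ecc. c i *s raise i v)"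
    using assms(2) unfolding in_ladder_span_def by auto
  have "ladder \<kappa> \<theta> v \<Longrightarrow> f v + g v = (\<Sum>i\<le>ecc. (b i + c i) *s raise i v)" for v
    by (simp add: b c sum.distrib vector_sadd_rdistrib)
  then show ?thesis unfolding in_ladder_span_def by (intro exI[of _ "\<lambda>i. b i + c i"]) blast
qed

lemma in_ladder_span_scale:
  assumes "in_ladder_span \<kappa> \<theta> f"
  shows "in_ladder_span \<kappa> \<theta> (\<lambda>v. b *s f v)"
proof -
  obtain c where c: "\<And>v. ladder \<kappa> \<theta> v \<Longrightarrow> f v = (\<Sum>i\<le>ecc. c i *s raise i v)"
    using assms unfolding in_ladder_span_def by auto
  have "ladder \<kappa> \<theta> v \<Longrightarrow> b *s f v = (\<Sum>i\<le>ecc. (b * c i) *s raise i v)" for v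
    by (simp add: c vec.scale_sum_right)
  then show ?thesis unfolding in_ladder_span_def by (intro exI[of _ "\<lambda>i. b * c i"]) blast
qed

lemma in_ladder_span_zero: "in_ladder_span \<kappa> \<theta> (\<lambda>v. 0)"
  using in_ladder_span_scale[OF in_ladder_span_raise, of \<kappa> \<theta> 0] by simp

lemma in_ladder_span_sum:
  assumes "finite I" "\<And>i. i \<in> I \<Longrightarrow> in_ladder_span \<kappa> \<theta> (f i)"
  shows "in_ladder_span \<kappa> \<theta> (\<lambda>v. \<Sum>i\<in>I. f i v)"
  using assms by (induction I) (auto intro: in_ladder_span_zero in_ladder_span_add)

lemma in_ladder_span_flat: "in_ladder_span \<kappa> \<theta> (\<lambda>v. flat (raise j v))"
  by (rule in_ladder_span_cong[OF in_ladder_span_scale[OF in_ladder_span_raise, of _ _ "\<theta> j" j]])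
    (simp add: ladder_def)

lemma in_ladder_span_lower: "in_ladder_span \<kappa> \<theta> (\<lambda>v. lower (raise j v))"
proof (cases j)
  case 0
  show ?thesis
    by (rule in_ladder_span_cong[OF in_ladder_span_zero]) (simp add: ladder_def 0)
next
  case (Suc m)
  show ?thesis
    by (rule in_ladder_span_cong[OF in_ladder_span_scale[OF in_ladder_span_raise, of _ _ "\<kappa> m" m]])
      (simp add: ladder_def Suc)
qed

text \<open>
  The matrices that map every \<open>R\<^sup>j v\<close> uniformly into the span of the \<open>R\<^sup>i v\<close> form a subalgebra.  It
  contains \<open>A = R + F + L\<close> by the ladder equations, and the dual idempotents because \<open>R\<^sup>j v\<close> lives on
  level \<open>j + 1\<close>.
\<close>

lemma terwilliger_in_ladder_span:
  assumes "B \<in> T" shows "in_ladder_span \<kappa> \<theta> (\<lambda>v. B *v raise j v)"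
proof -
  define Q where "Q = {B. \<forall>j. in_ladder_span \<kappa> \<theta> (\<lambda>v. B *v raise j v)}"
  have adj: "adjacency_matrix E \<in> Q"
  proof -
    have "in_ladder_span \<kappa> \<theta> (\<lambda>v. raise (Suc j) v + flat (raise j v) + lower (raise j v))" for j
      by (intro in_ladder_span_add in_ladder_span_raise in_ladder_span_flat in_ladder_span_lower)
    moreover have "adjacency_matrix E *v raise j v =
        raise (Suc j) v + flat (raise j v) + lower (raise j v)" for j v
      by (simp add: adjacency_step_decomposition[of x] matrix_vector_mult_add_rdistrib raise_power_Suc
         )
    ultimately show ?thesis unfolding Q_def by simp
  qed
  have idem: "dual_idempotent E x k \<in> Q" for k
  proof -
    have "in_ladder_span \<kappa> \<theta> (\<lambda>v. proj k (raise j v))" for j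
      by (rule in_ladder_span_cong[OF in_ladder_span_scale[OF in_ladder_span_raise,
              of _ _ "if k = Suc j then 1 else 0" j]])
        (simp add: dual_idempotent_level[OF level_raise_ladder])
    then show ?thesis by (simp add: Q_def)
  qed
  have mult: "M ** N \<in> Q" if M: "M \<in> Q" and N: "N \<in> Q" for M N
  proof -
    have "in_ladder_span \<kappa> \<theta> (\<lambda>v. (M ** N) *v raise j v)" for j
    proof -
      obtain c where c: "ladder \<kappa> \<theta> v \<Longrightarrow> N *v raise j v = (\<Sum>i\<le>ecc. c i *s raise i v)" for v
        using N unfolding Q_def in_ladder_span_def by auto
      have "in_ladder_span \<kappa> \<theta> (\<lambda>v. \<Sum>i\<le>ecc. c i *s (M *v raise i v))"
        using M by (intro in_ladder_span_sum in_ladder_span_scale) (auto simp: Q_def)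
      then show ?thesis
        by (rule in_ladder_span_cong)
          (simp only: c vec.sum vec.scale matrix_vector_mul_assoc[symmetric])
    qed
    then show ?thesis by (simp add: Q_def)
  qed
  have scale: "(\<chi> i j. b * M $ i $ j) \<in> Q" if "M \<in> Q" for b M
    using that by (simp add: Q_def in_ladder_span_scale scaled_matrix_mult)
  have add: "M + N \<in> Q" if "M \<in> Q" "N \<in> Q" for M N
    using that by (simp add: Q_def matrix_vector_mult_add_rdistrib in_ladder_span_add)
  have one: "mat 1 \<in> Q"
    by (simp add: Q_def in_ladder_span_raise)
  have "matrix_subalgebra Q"
    unfolding matrix_subalgebra_def using one add scale mult by blast
  with adj idem have "T \<subseteq> Q"
    unfolding terwilliger_algebra_def by (intro hull_minimal) auto
  with assms show ?thesis by (auto simp: Q_def)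
qed

text \<open>
  Among the \<open>R\<^sup>i v\<close>, at most one lives on a given level (none on level 0), so cutting \<open>B v\<close> down to a level leaves a multiple
  of a single \<open>R\<^sup>i v\<close>, with a factor that is again independent of \<open>v\<close>.
\<close>

lemma ladder_compression:
  assumes "B \<in> T"
  obtains c where "\<And>v. ladder \<kappa> \<theta> v \<Longrightarrow> proj (Suc i) (B *v v) = c *s raise i v"
    and "\<And>v. ladder \<kappa> \<theta> v \<Longrightarrow> proj 0 (B *v v) = 0"
proof -
  obtain c where c: "ladder \<kappa> \<theta> v \<Longrightarrow> B *v v = (\<Sum>i\<le>ecc. c i *s raise i v)" for v
    using terwilliger_in_ladder_span[OF assms, of \<kappa> \<theta> 0] unfolding in_ladder_span_def by auto
  have *: "proj k (B *v v) = (\<Sum>j\<le>ecc. if k = Suc j then c j *s raise j v else 0)"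
    if "ladder \<kappa> \<theta> v" for k v
    by (auto simp: c that vec.sum vec.scale dual_idempotent_level[OF level_raise_ladder[OF that]] intro!: sum.cong)
  show thesis
  proof (rule that)
    fix v assume v: "ladder \<kappa> \<theta> v"
    show "proj 0 (B *v v) = 0" by (simp add: *[OF v])
    show "proj (Suc i) (B *v v) = (if i \<le> ecc then c i else 0) *s raise i v"
      by (simp add: *[OF v])
  qed
qed

section \<open>Cyclic modules and orthogonal complements\<close>

definition cyclic :: "complex^'a \<Rightarrow> (complex^'a) set" where
  "cyclic v = {B *v v | B. B \<in> T}"

lemma t_module_cyclic: "t_module E x (cyclic v)"
proof -
  have "c *s u \<in> cyclic v" if u: "u \<in> cyclic v" for c u
  proof -
    obtain B where B: "B \<in> T" "u = B *v v" using u by (auto simp: cyclic_def)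
    have "c *s u = (\<chi> i j. c * B $ i $ j) *v v" by (simp add: B(2) scaled_matrix_mult)
    then show ?thesis using terwilliger_scale[OF B(1), of c] unfolding cyclic_def by blast
  qed
  moreover have "u + w \<in> cyclic v" if "u \<in> cyclic v" "w \<in> cyclic v" for u w
    using that terwilliger_add[of _ E x] unfolding cyclic_def
    by clarsimp (metis matrix_vector_mult_add_rdistrib)
  moreover have "0 \<in> cyclic v"
    using terwilliger_zero[of E x] unfolding cyclic_def by force
  moreover have "B *v u \<in> cyclic v" if "u \<in> cyclic v" "B \<in> T" for B u
    using that terwilliger_mult[of _ E x] unfolding cyclic_def by (auto simp: matrix_vector_mul_assoc)
  ultimately show ?thesis unfolding t_module_def vec.subspace_def by blast
qed

lemma generator_in_cyclic: "v \<in> cyclic v"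
  using terwilliger_one[of E x] unfolding cyclic_def by force

lemma cyclic_subset:
  assumes "t_module E x W" "v \<in> W" shows "cyclic v \<subseteq> W"
  using assms unfolding cyclic_def t_module_def by auto

lemma t_module_subspace: "t_module E x W \<Longrightarrow> vec.subspace W"
  and t_module_mult: "t_module E x W \<Longrightarrow> B \<in> T \<Longrightarrow> w \<in> W \<Longrightarrow> B *v w \<in> W"
  by (auto simp: t_module_def)

lemma t_module_zero: "t_module E x W \<Longrightarrow> 0 \<in> W"
  by (simp add: t_module_def vec.subspace_0)

lemma t_module_proj: "t_module E x W \<Longrightarrow> w \<in> W \<Longrightarrow> proj i w \<in> W"
  using t_module_mult dual_idempotent_in_terwilliger by blast

text \<open>
  The adjoint of \<open>B \<in> T\<close> is in \<open>T\<close> and can be moved to the other side of the inner product.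
\<close>

lemma cyclic_orthogonal:
  assumes "t_module E x W" "\<And>w. w \<in> W \<Longrightarrow> v \<bullet> w = 0" "u \<in> cyclic v" "w \<in> W"
  shows "u \<bullet> w = 0"
proof -
  obtain B where B: "B \<in> T" "u = B *v v" using assms(3) by (auto simp: cyclic_def)
  show ?thesis
    using assms(1,2,4) adjoint_terwilliger[OF sym B(1)]
    by (simp add: B(2) inner_adjoint t_module_mult)
qed

lemma t_module_orthogonal:
  assumes "t_module E x W" "t_module E x P"
  shows "t_module E x {w \<in> W. \<forall>p\<in>P. w \<bullet> p = 0}"
proof -
  have "(B *v w) \<bullet> p = 0" if "B \<in> T" "\<forall>p\<in>P. w \<bullet> p = 0" "p \<in> P" for B w p
    using that assms(2) adjoint_terwilliger[OF sym that(1)] by (simp add: inner_adjoint t_module_mult)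
  moreover have "(c *s w) \<bullet> p = 0" if "\<forall>p\<in>P. w \<bullet> p = 0" "p \<in> P" for c w p
    using that t_module_subspace[OF assms(2)] by (simp add: inner_scale_left vec.subspace_scale)
  ultimately show ?thesis
    using assms(1) unfolding t_module_def vec.subspace_def by (auto simp: inner_add_left)
qed

lemma dual_component_eq_0_iff:
  assumes "t_module E x W"
  shows "dual_component E x i W = {0} \<longleftrightarrow> (\<forall>w\<in>W. proj i w = 0)"
  using t_module_zero[OF assms] unfolding dual_component_def by force

text \<open>
  The endpoint is a minimum over a set of levels; that set is nonempty because a nonzero
  vector has a nonzero component on some level.
\<close>

lemma endpoint_1_iff:
  assumes W: "t_module E x W" "W \<noteq> {0}"
  shows "endpoint E x W = 1 \<longleftrightarrow> (\<forall>w\<in>W. proj 0 w = 0) \<and> (\<exists>w\<in>W. proj 1 w \<noteq> 0)"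
proof -
  let ?I = "{i. i \<le> ecc \<and> dual_component E x i W \<noteq> {0}}"
  have I: "i \<in> ?I \<longleftrightarrow> (\<exists>w\<in>W. proj i w \<noteq> 0)" for i
    using at_level_imp_zero[OF at_level_dual_idempotent, of E x i]
      dual_component_eq_0_iff[OF W(1), of i] not_le by blast
  obtain w where w: "w \<in> W" "w \<noteq> 0" using W t_module_zero by blast
  then obtain y where "w $ y \<noteq> 0" by (auto simp: vec_eq_iff)
  then have "proj (gdist E x y) w \<noteq> 0" by (metis dual_idempotent_mult zero_index)
  with I w have ne: "?I \<noteq> {}" by blast
  have "Min ?I = 1 \<longleftrightarrow> 0 \<notin> ?I \<and> 1 \<in> ?I"
  proof
    assume "Min ?I = 1"
    moreover have "Min ?I \<in> ?I" using ne by (intro Min_in) auto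
    moreover have "0 \<in> ?I \<Longrightarrow> Min ?I \<le> 0" by (rule Min_le) auto
    ultimately show "0 \<notin> ?I \<and> 1 \<in> ?I" by (metis not_one_le_zero)
  next
    assume *: "0 \<notin> ?I \<and> 1 \<in> ?I"
    show "Min ?I = 1"
    proof (rule Min_eqI)
      fix i assume "i \<in> ?I"
      with * show "1 \<le> i" by (cases i) auto
    qed (use * in auto)
  qed
  then show ?thesis unfolding endpoint_def I by blast
qed

section \<open>Modules generated by ladder vectors\<close>

lemma cyclic_ladder_component:
  assumes "ladder \<kappa> \<theta> v" "u \<in> cyclic v"
  shows "proj 0 u = 0" "\<exists>c. proj (Suc i) u = c *s raise i v"
proof -
  obtain B where B: "B \<in> T" "u = B *v v" using assms(2) by (auto simp: cyclic_def)
  obtain c where "\<And>v. ladder \<kappa> \<theta> v \<Longrightarrow> proj (Suc i) (B *v v) = c *s raise i v"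
    and "\<And>v. ladder \<kappa> \<theta> v \<Longrightarrow> proj 0 (B *v v) = 0"
    using ladder_compression[OF B(1)] by blast
  with assms(1) B(2) show "proj 0 u = 0" "\<exists>c. proj (Suc i) u = c *s raise i v" by auto
qed

lemma thin_cyclic_ladder:
  assumes "ladder \<kappa> \<theta> v" shows "thin E x (cyclic v)"
  unfolding thin_def dual_component_def
proof (intro allI impI)
  fix i
  show "vec.dim (proj i ` cyclic v) \<le> 1"
  proof (cases i)
    case 0
    show ?thesis
      by (rule dim_le_1_if_proportional[of _ 0]) (auto simp: 0 cyclic_ladder_component[OF assms])
  next
    case (Suc j)
    show ?thesis
      by (rule dim_le_1_if_proportional[of _ "raise j v"])
        (auto simp: Suc cyclic_ladder_component[OF assms])
  qed
qed

lemma endpoint_cyclic_ladder: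
  assumes "ladder \<kappa> \<theta> v" "v \<noteq> 0" shows "endpoint E x (cyclic v) = 1"
proof -
  have "proj 1 v = v" using assms(1) dual_idempotent_level[of E x 1 v 1] by (simp add: ladder_def)
  moreover have "cyclic v \<noteq> {0}" using generator_in_cyclic[of v] assms(2) by auto
  ultimately show ?thesis
    using endpoint_1_iff[OF t_module_cyclic] cyclic_ladder_component(1)[OF assms(1)]
      generator_in_cyclic[of v] assms(2) by metis
qed

text \<open>
  The module meets level 1 only in the line through \<open>v\<close>.  A submodule therefore either contains \<open>v\<close>,
  and is everything, or is orthogonal to \<open>v\<close>, hence to all of \<open>T v\<close>, hence to itself.
\<close>

lemma irreducible_cyclic_ladder:
  assumes v: "ladder \<kappa> \<theta> v" "v \<noteq> 0" shows "irreducible_t_module E x (cyclic v)"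
proof -
  have "P = {0} \<or> P = cyclic v" if P: "t_module E x P" "P \<subseteq> cyclic v" for P
  proof (cases "\<exists>p\<in>P. proj 1 p \<noteq> 0")
    case True
    then obtain p where p: "p \<in> P" "proj 1 p \<noteq> 0" by blast
    then obtain c where c: "proj 1 p = c *s v"
      using cyclic_ladder_component(2)[OF v(1), of p 0] P(2) by auto
    then have "c \<noteq> 0" using p(2) by auto
    have "(1 / c) *s (c *s v) \<in> P"
      using t_module_proj[OF P(1) p(1), of 1] c t_module_subspace[OF P(1)]
      by (metis vec.subspace_scale)
    with \<open>c \<noteq> 0\<close> have "v \<in> P" by simp
    then have "cyclic v \<subseteq> P" by (rule cyclic_subset[OF P(1)])
    with P(2) show ?thesis by blast
  next
    case False
    have "v \<bullet> p = 0" if "p \<in> P" for p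
    proof -
      have "v \<bullet> p = proj 1 v \<bullet> p"
        using v(1) dual_idempotent_level[of E x 1 v 1] by (simp add: ladder_def)
      also have "\<dots> = 0" using False that by (simp only: inner_dual_idempotent) simp
      finally show ?thesis .
    qed
    then have "p \<bullet> p = 0" if "p \<in> P" for p
      using cyclic_orthogonal[OF P(1), of v p p] P(2) that by blast
    then show ?thesis using t_module_zero[OF P(1)] by auto
  qed
  moreover have "cyclic v \<noteq> {0}" using generator_in_cyclic[of v] v(2) by auto
  ultimately show ?thesis unfolding irreducible_t_module_def using t_module_cyclic by blast
qed

text \<open>
  On level 1, \<open>B\<^sup>* B\<close> maps every ladder with the given scalars to the same multiple of itself, so
  \<open>\<parallel>B v\<parallel>\<^sup>2\<close> and \<open>\<parallel>B w\<parallel>\<^sup>2\<close> have the same ratio to \<open>\<parallel>v\<parallel>\<^sup>2\<close> and \<open>\<parallel>w\<parallel>\<^sup>2\<close>.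
\<close>

lemma annihilator_ladder:
  assumes B: "B \<in> T" and v: "ladder \<kappa> \<theta> v" "v \<noteq> 0" and w: "ladder \<kappa> \<theta> w" and 0: "B *v v = 0"
  shows "B *v w = 0"
proof -
  have BB: "adjoint_matrix B ** B \<in> T"
    using B adjoint_terwilliger[OF sym B] by (rule terwilliger_mult[rotated])
  obtain c where c: "\<And>v. ladder \<kappa> \<theta> v \<Longrightarrow> proj (Suc 0) ((adjoint_matrix B ** B) *v v) = c *s raise 0 v"
    using ladder_compression[OF BB] by blast
  have "c *s v = 0"
    using c[OF v(1)] 0 by (simp flip: matrix_vector_mul_assoc)
  with v(2) have "proj 1 (adjoint_matrix B *v (B *v w)) = 0"
    using c[OF w] by (simp add: matrix_vector_mul_assoc)
  then have "proj 1 w \<bullet> (adjoint_matrix B *v (B *v w)) = 0"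
    by (simp only: inner_dual_idempotent) simp
  moreover have "proj 1 w = w"
    using w dual_idempotent_level[of E x 1 w 1] by (simp add: ladder_def)
  ultimately have "(B *v w) \<bullet> (B *v w) = 0" by (simp only: inner_adjoint)
  then show ?thesis by simp
qed

text \<open>
  The isomorphism is \<open>B v \<mapsto> B w\<close>: equality of annihilators makes it well defined and injective.
\<close>

lemma cyclic_ladder_isomorphic:
  assumes v: "ladder \<kappa> \<theta> v" "v \<noteq> 0" and w: "ladder \<kappa> \<theta> w" "w \<noteq> 0"
  shows "t_isomorphic E x (cyclic v) (cyclic w)"
proof -
  have iff: "B *v v = C *v v \<longleftrightarrow> B *v w = C *v w" if "B \<in> T" "C \<in> T" for B C
    using annihilator_ladder[OF terwilliger_diff[OF that] v w(1)]
      annihilator_ladder[OF terwilliger_diff[OF that] w v(1)]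
    by (auto simp: matrix_vector_mult_diff_rdistrib)
  \<comment> \<open>The choice of \<open>B\<close> does not matter, by the previous fact.\<close>
  define \<sigma> where "\<sigma> u = (SOME B. B \<in> T \<and> B *v v = u) *v w" for u
  have \<sigma>: "\<sigma> (B *v v) = B *v w" if B: "B \<in> T" for B
  proof -
    have "(SOME C. C \<in> T \<and> C *v v = B *v v) \<in> T \<and> (SOME C. C \<in> T \<and> C *v v = B *v v) *v v = B *v v"
      by (rule someI[of "\<lambda>C. C \<in> T \<and> C *v v = B *v v" B]) (simp add: B)
    then show ?thesis using iff[OF _ B] unfolding \<sigma>_def by blast
  qed
  have "bij_betw \<sigma> (cyclic v) (cyclic w)"
  proof (rule bij_betw_imageI)
    show "inj_on \<sigma> (cyclic v)" by (rule inj_onI) (auto simp: cyclic_def \<sigma> iff)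
    show "\<sigma> ` cyclic v = cyclic w"
      unfolding cyclic_def by (auto simp: \<sigma>) (metis (mono_tags, lifting) \<sigma> image_eqI mem_Collect_eq)
  qed
  moreover have "\<sigma> (a + b) = \<sigma> a + \<sigma> b" if ab: "a \<in> cyclic v" "b \<in> cyclic v" for a b
  proof -
    obtain A B where "A \<in> T" "a = A *v v" "B \<in> T" "b = B *v v" using ab by (auto simp: cyclic_def)
    then show ?thesis using \<sigma>[OF terwilliger_add, of A B]
      by (simp add: \<sigma> matrix_vector_mult_add_rdistrib)
  qed
  moreover have "\<sigma> (c *s a) = c *s \<sigma> a" if a: "a \<in> cyclic v" for c a
  proof -
    obtain A where "A \<in> T" "a = A *v v" using a by (auto simp: cyclic_def)
    then show ?thesis using \<sigma>[OF terwilliger_scale, of A c] by (simp add: \<sigma> scaled_matrix_mult)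
  qed
  moreover have "\<sigma> (B *v a) = B *v \<sigma> a" if B: "B \<in> T" and a: "a \<in> cyclic v" for B a
  proof -
    obtain A where "A \<in> T" "a = A *v v" using a by (auto simp: cyclic_def)
    then show ?thesis using \<sigma>[OF terwilliger_mult[OF B], of A] B
      by (simp add: \<sigma> matrix_vector_mul_assoc)
  qed
  ultimately show ?thesis unfolding t_isomorphic_def by blast
qed

section \<open>Irreducible modules with endpoint one\<close>

lemma lower_eq_0_if_proj_0:
  assumes "t_module E x W" "\<And>w. w \<in> W \<Longrightarrow> proj 0 w = 0" "w \<in> W" "level 1 w"
  shows "lower w = 0"
proof -
  have "lower w \<in> W" using assms(1,3) t_module_mult step_matrix_in_terwilliger by blast
  then have "proj 0 (lower w) = 0" by (rule assms(2))
  moreover have "level 0 (lower w)" using assms(4) at_level_lower[of E x 0 w] by simp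
  ultimately show ?thesis using dual_idempotent_level[of E x 0 "lower w" 0] by simp
qed

lemma endpoint_1_vector:
  assumes W: "irreducible_t_module E x W" "endpoint E x W = 1"
  obtains w where "w \<in> W" "w \<noteq> 0" "level 1 w" "lower w = 0"
proof -
  have mod: "t_module E x W" "W \<noteq> {0}" using W(1) by (auto simp: irreducible_t_module_def)
  then obtain u where "\<forall>w\<in>W. proj 0 w = 0" and u: "u \<in> W" "proj 1 u \<noteq> 0"
    using endpoint_1_iff[OF mod] W(2) by blast
  then have "lower (proj 1 u) = 0"
    using lower_eq_0_if_proj_0[OF mod(1) _ t_module_proj[OF mod(1) u(1)] at_level_dual_idempotent]
    by blast
  then show thesis
    by (rule that[OF t_module_proj[OF mod(1) u(1)] u(2) at_level_dual_idempotent])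
qed

text \<open>
  Take a submodule that is minimal among those with a nonzero component on level 1.  If it had a
  proper nonzero submodule \<open>P\<close>, then \<open>P\<close> would vanish on level 1 by minimality, and so the orthogonal
  complement of \<open>P\<close> would keep the whole level 1, contradicting minimality.
\<close>

lemma exists_irreducible_endpoint_1:
  assumes "t_module E x M" "\<And>w. w \<in> M \<Longrightarrow> proj 0 w = 0" "u \<in> M" "proj 1 u \<noteq> 0"
  obtains W where "W \<subseteq> M" "irreducible_t_module E x W" "endpoint E x W = 1"
proof -
  define C where "C W \<longleftrightarrow> t_module E x W \<and> W \<subseteq> M \<and> (\<exists>w\<in>W. proj 1 w \<noteq> 0)" for W
  have "C M" using assms by (auto simp: C_def)
  then obtain W where W: "C W" "\<And>W'. C W' \<Longrightarrow> vec.dim W \<le> vec.dim W'"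
    using exists_least_iff[of "\<lambda>n. \<exists>W. C W \<and> vec.dim W = n"] by (metis not_le)
  have mod: "t_module E x W" "W \<subseteq> M" using W(1) by (auto simp: C_def)
  obtain w where w: "w \<in> W" "proj 1 w \<noteq> 0" using W(1) by (auto simp: C_def)
  have sub: "P = W" if "C P" "P \<subseteq> W" for P
    using vec.subspace_dim_equal[of P W] that W(2)[OF that(1)] mod
    by (auto simp: C_def t_module_subspace)
  have "P = {0} \<or> P = W" if P: "t_module E x P" "P \<subseteq> W" for P
  proof (cases "\<exists>p\<in>P. proj 1 p \<noteq> 0")
    case True
    then have "C P" using P mod by (auto simp: C_def)
    then show ?thesis using sub P by blast
  next
    case False
    let ?Q = "{q \<in> W. \<forall>p\<in>P. q \<bullet> p = 0}"
    have "\<forall>p\<in>P. proj 1 w \<bullet> p = 0" using False by (simp only: inner_dual_idempotent) simp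
    then have "proj 1 w \<in> ?Q" using t_module_proj[OF mod(1) w(1)] by blast
    moreover have "proj 1 (proj 1 w) \<noteq> 0"
      using w(2) dual_idempotent_level[OF at_level_dual_idempotent[of E x 1 w], of 1] by simp
    ultimately have "C ?Q"
      using t_module_orthogonal[OF mod(1) P(1)] mod(2) unfolding C_def by blast
    then have "?Q = W" by (rule sub) auto
    then have "\<forall>p\<in>P. p \<bullet> p = 0" using P(2) by blast
    then show ?thesis using t_module_zero[OF P(1)] by auto
  qed
  moreover have "W \<noteq> {0}" using w by auto
  ultimately have "irreducible_t_module E x W"
    using mod by (auto simp: irreducible_t_module_def)
  moreover have "endpoint E x W = 1"
    using endpoint_1_iff[OF mod(1) \<open>W \<noteq> {0}\<close>] w mod(2) assms(2) by blast
  ultimately show thesis using that mod(2) by blast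
qed

lemma ladder_scale: "ladder \<kappa> \<theta> v \<Longrightarrow> ladder \<kappa> \<theta> (c *s v)"
  unfolding ladder_def by (simp add: at_level_scale vec.scale vec.scale_left_commute)

lemma ladder_zero: "ladder \<kappa> \<theta> 0"
  unfolding ladder_def by (simp add: at_level_zero)

lemma ladder_add: "ladder \<kappa> \<theta> u \<Longrightarrow> ladder \<kappa> \<theta> v \<Longrightarrow> ladder \<kappa> \<theta> (u + v)"
  unfolding ladder_def by (simp add: at_level_add vec.add vec.scale_right_distrib)

lemma t_module_raise: "t_module E x W \<Longrightarrow> w \<in> W \<Longrightarrow> raise i w \<in> W"
  using t_module_mult walk_matrix_in_terwilliger unfolding raise_power_def by blast

lemma thin_proportional:
  assumes W: "t_module E x W" "thin E x W" and a: "a \<in> W" "level i a" "a \<noteq> 0"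
    and b: "b \<in> W" "level i b"
  obtains c where "b = c *s a"
proof -
  have "i \<le> ecc" using at_level_imp_zero[OF a(2)] a(3) by (meson not_le)
  then have "vec.dim (dual_component E x i W) \<le> 1" using W(2) by (simp add: thin_def)
  moreover have "u \<in> dual_component E x i W" if "u \<in> W" "level i u" for u
    using that dual_idempotent_level[OF that(2), of i] by (force simp: dual_component_def)
  ultimately show thesis using proportional_if_dim_le_1[OF _ _ a(3)] a b that by metis
qed

text \<open>
  In a thin module, a nonzero \<open>R\<^sup>j w\<close> spans its level, and \<open>L R\<^bsup>j+1\<^esup> w\<close> and \<open>F R\<^sup>j w\<close> lie on the same level.
  If \<open>R\<^sup>j w = 0\<close>, both of these are zero and any scalars will do.
\<close>

lemma thin_vector_is_ladder:
  assumes W: "t_module E x W" "thin E x W" and w: "w \<in> W" "level 1 w" "lower w = 0"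
  obtains \<kappa> \<theta> where "ladder \<kappa> \<theta> w"
proof -
  have step: "step_matrix E x t *v u \<in> W" if "u \<in> W" for t u
    using that W(1) t_module_mult step_matrix_in_terwilliger by blast
  have "\<exists>k t. lower (raise (Suc j) w) = k *s raise j w \<and> flat (raise j w) = t *s raise j w" for j
  proof (cases "raise j w = 0")
    case True
    then show ?thesis by (simp add: raise_power_Suc)
  next
    case False
    have lev: "level (Suc m) (raise m w)" for m using at_level_raise_power[OF w(2), of m] by simp
    note proportional = thin_proportional[OF W t_module_raise[OF W(1) w(1)] lev[of j] False]
    obtain k where "lower (raise (Suc j) w) = k *s raise j w"
      by (rule proportional[OF step[OF t_module_raise[OF W(1) w(1)]] at_level_lower[OF lev]])
    moreover obtain t where "flat (raise j w) = t *s raise j w"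
      by (rule proportional[OF step[OF t_module_raise[OF W(1) w(1)]] at_level_flat[OF lev]])
    ultimately show ?thesis by blast
  qed
  then obtain \<kappa> \<theta> where "\<And>j. lower (raise (Suc j) w) = \<kappa> j *s raise j w \<and> flat (raise j w) = \<theta> j *s raise j w"
    by metis
  with w that show thesis unfolding ladder_def by blast
qed

text \<open>
  The preimage of \<open>w'\<close> is on level 1 of \<open>W\<close>, hence a multiple of \<open>w\<close> by thinness; the ladder equations are
  equations between elements of \<open>T\<close> and pass through the isomorphism.
\<close>

lemma isomorphic_vector_is_ladder:
  assumes iso: "t_isomorphic E x W W'" and W: "t_module E x W" "thin E x W"
    and w: "w \<in> W" "w \<noteq> 0" "ladder \<kappa> \<theta> w" and w': "w' \<in> W'" "level 1 w'"
  shows "ladder \<kappa> \<theta> w'"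
proof -
  obtain \<sigma> where bij: "bij_betw \<sigma> W W'"
    and scale: "\<And>c u. u \<in> W \<Longrightarrow> \<sigma> (c *s u) = c *s \<sigma> u"
    and comm: "\<And>B u. B \<in> T \<Longrightarrow> u \<in> W \<Longrightarrow> \<sigma> (B *v u) = B *v \<sigma> u"
    using iso unfolding t_isomorphic_def by blast
  have \<sigma>0: "\<sigma> 0 = 0" using scale[OF w(1), of 0] by simp
  obtain u where u: "u \<in> W" "\<sigma> u = w'" using bij w'(1) by (auto simp: bij_betw_def)
  have "\<sigma> (proj 1 u) = \<sigma> u"
    using comm[OF dual_idempotent_in_terwilliger u(1)] dual_idempotent_level[OF w'(2), of 1] u(2) by simp
  then have "proj 1 u = u"
    using bij u(1) t_module_proj[OF W(1) u(1)] by (auto simp: bij_betw_def inj_on_def)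
  then have "level 1 u" by (metis at_level_dual_idempotent)
  then obtain c where "u = c *s w"
    using thin_proportional[OF W w(1) _ w(2) u(1)] w(3) ladder_def by blast
  then have lad: "ladder \<kappa> \<theta> u" using ladder_scale[OF w(3)] by simp
  have raise: "\<sigma> (raise j u) = raise j w'" for j
    using comm[OF walk_matrix_in_terwilliger u(1)] u(2) by (simp add: raise_power_def)
  have step: "\<sigma> (step_matrix E x t *v a) = step_matrix E x t *v \<sigma> a" if "a \<in> W" for a t
    using comm[OF step_matrix_in_terwilliger that] .
  have "lower w' = 0" using step[OF u(1), of Lower] u(2) lad \<sigma>0 by (simp add: ladder_def)
  moreover have "lower (raise (Suc j) w') = \<kappa> j *s raise j w'" for j
    using step[OF t_module_raise[OF W(1) u(1)], of Lower "Suc j"] lad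
    by (simp add: raise ladder_def scale t_module_raise[OF W(1) u(1)])
  moreover have "flat (raise j w') = \<theta> j *s raise j w'" for j
    using step[OF t_module_raise[OF W(1) u(1)], of Flat j] lad
    by (simp add: raise ladder_def scale t_module_raise[OF W(1) u(1)])
  ultimately show ?thesis using w'(2) by (simp add: ladder_def)
qed

section \<open>Walk conditions as operator identities\<close>

abbreviation vertex :: "'a \<Rightarrow> complex^'a" where "vertex y \<equiv> axis y 1"

lemma matrix_vertex_entry: "(M *v vertex y) $ z = M $ z $ y" for M :: "complex^'a^'a"
  by (simp add: matrix_vector_mult_def axis_def if_distrib[of "(*) _"] cong: if_cong)

lemma walk_matrix_vertex: "(walk_matrix E x ts *v vertex y) $ z = of_nat (num_walks E x ts y z)"
  by (simp add: matrix_vertex_entry walk_matrix_entry)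

lemma walks_r_raise: "walks_r E x m y z = raise m (vertex y) $ z"
  by (simp add: walks_r_def raise_power_def walk_matrix_vertex)

lemma walks_rl_raise: "walks_rl E x m y z = lower (raise m (vertex y)) $ z"
proof -
  have "lower (raise m (vertex y)) = walk_matrix E x (replicate m Rise @ [Lower]) *v vertex y"
    by (simp add: walk_matrix_append raise_power_def matrix_vector_mul_assoc)
  then show ?thesis by (simp only: walks_rl_def walk_matrix_vertex)
qed

lemma walks_rf_raise: "walks_rf E x m y z = flat (raise m (vertex y)) $ z"
proof -
  have "flat (raise m (vertex y)) = walk_matrix E x (replicate m Rise @ [Flat]) *v vertex y"
    by (simp add: walk_matrix_append raise_power_def matrix_vector_mul_assoc)
  then show ?thesis by (simp only: walks_rf_def walk_matrix_vertex)
qed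

lemma walks_lr_raise: "walks_lr E x m y z = raise m (lower (vertex y)) $ z"
proof -
  have "raise m (lower (vertex y)) = walk_matrix E x (Lower # replicate m Rise) *v vertex y"
    by (simp add: raise_power_def matrix_vector_mul_assoc)
  then show ?thesis by (simp only: walks_lr_def walk_matrix_vertex)
qed

lemma level_vertex: "level (gdist E x y) (vertex y)"
  by (auto simp: at_level_def axis_def)

lemma step_matrix_vertex:
  "(step_matrix E x t *v vertex y) $ z = (if E y z \<and> is_step E x t y z then 1 else 0)"
  by (simp add: matrix_vertex_entry step_matrix_def)

text \<open>
  This is why walk counts of shape \<open>\<ell>r\<^sup>i\<close> from a neighbour \<open>y\<close> of \<open>x\<close> do not depend on \<open>y\<close>.
\<close>

lemma lower_vertex:
  assumes "y \<in> sphere_at E 1 x" shows "lower (vertex y) = vertex x"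
proof -
  have y: "gdist E x y = 1" using assms by (simp add: sphere_at_def)
  then have "E y x" using gdist_eq_1_imp_edge sym by (auto simp: symp_def)
  moreover have "is_step E x Lower y z \<longleftrightarrow> z = x" for z
    using gdist_eq_0_iff[of E x z] conn y by auto
  ultimately have "(lower (vertex y)) $ z = vertex x $ z" for z
    unfolding step_matrix_vertex by (simp add: axis_def del: is_step.simps)
  then show ?thesis by (simp add: vec_eq_iff)
qed

lemma raise_vertex_root_nonzero: "raise (gdist E x z) (vertex x) $ z \<noteq> 0"
  using ascending_walk_exists[of x z]
  by (simp add: raise_power_def walk_matrix_vertex)

lemma distance_trichotomy:
  assumes "y \<in> sphere_at E 1 x" "gdist E x z = Suc j"
  shows "gdist E y z = Suc (Suc j) \<or> gdist E y z = Suc j \<or> gdist E y z = j"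
proof -
  have "E x y" using assms(1) gdist_eq_1_imp_edge by (simp add: sphere_at_def)
  then have "gdist E x z \<le> Suc (gdist E y z)" "gdist E y z \<le> Suc (gdist E x z)"
    using gdist_step_left sym by (auto simp: symp_def)
  with assms(2) show ?thesis by linarith
qed

text \<open>
  The two parts of the walk conditions are one equation: a walk of length \<open>j\<close> cannot bridge a
  distance exceeding \<open>j\<close>, so the terms with \<open>\<kappa>\<close> and \<open>\<theta>\<close> are absent from part (a) only because they are zero
  there.  The three distance sets cover the whole level \<open>Suc j\<close>, and off this level
  all vectors involved vanish.
\<close>

lemma walk_conditions_iff:
  "walk_conditions E x (Suc j) \<kappa> \<mu> \<theta> \<rho> \<longleftrightarrow>
     (\<forall>y\<in>sphere_at E 1 x.
        lower (raise (Suc j) (vertex y)) =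
          \<kappa> *s raise j (vertex y) + \<mu> *s raise (Suc j) (lower (vertex y)) \<and>
        flat (raise j (vertex y)) =
          \<theta> *s raise j (vertex y) + \<rho> *s raise (Suc j) (lower (vertex y)))"
  (is "_ \<longleftrightarrow> (\<forall>y\<in>_. ?lower y \<and> ?flat y)")
proof -
  define holds where "holds y z \<longleftrightarrow>
      walks_rl E x (Suc j) y z = \<kappa> * walks_r E x j y z + \<mu> * walks_lr E x (Suc j) y z \<and>
      walks_rf E x j y z = \<theta> * walks_r E x j y z + \<rho> * walks_lr E x (Suc j) y z" for y z
  have far: "walks_r E x j y z = 0" if "j < gdist E y z" for y z
    using gdist_le_num_walks[of E x "replicate j Rise" y z] that by (auto simp: walks_r_def)
  have "walk_conditions E x (Suc j) \<kappa> \<mu> \<theta> \<rho> \<longleftrightarrow>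
      (\<forall>y\<in>sphere_at E 1 x. \<forall>z. gdist E x z = Suc j \<longrightarrow> holds y z)"
  proof -
    have "((\<forall>z\<in>dist_set E (Suc j) (Suc j + 1) x y \<union> dist_set E (Suc j) (Suc j) x y.
           walks_rl E x (Suc j) y z = \<mu> * walks_lr E x (Suc j) y z \<and>
           walks_rf E x (Suc j - 1) y z = \<rho> * walks_lr E x (Suc j) y z) \<and>
        (\<forall>z\<in>dist_set E (Suc j) (Suc j - 1) x y.
           walks_rl E x (Suc j) y z = \<kappa> * walks_r E x (Suc j - 1) y z + \<mu> * walks_lr E x (Suc j) y z \<and>
           walks_rf E x (Suc j - 1) y z = \<theta> * walks_r E x (Suc j - 1) y z + \<rho> * walks_lr E x (Suc j) y z))
       \<longleftrightarrow> (\<forall>z. gdist E x z = Suc j \<longrightarrow> holds y z)" (is "?A \<and> ?B \<longleftrightarrow> _")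
      if y: "y \<in> sphere_at E 1 x" for y
    proof (intro iffI allI impI)
      fix z assume AB: "?A \<and> ?B" and z: "gdist E x z = Suc j"
      show "holds y z"
        using distance_trichotomy[OF y z]
      proof (elim disjE)
        assume "gdist E y z = j"
        with AB z show ?thesis by (auto simp: dist_set_def sphere_at_def holds_def)
      qed (use AB z far[of y z] in \<open>auto simp: dist_set_def sphere_at_def holds_def\<close>)
    next
      assume *: "\<forall>z. gdist E x z = Suc j \<longrightarrow> holds y z"
      then show "?A \<and> ?B"
        using far[of y] by (auto simp: dist_set_def sphere_at_def holds_def)
    qed
    then show ?thesis unfolding walk_conditions_def by blast
  qed
  also have "\<dots> \<longleftrightarrow> (\<forall>y\<in>sphere_at E 1 x. ?lower y \<and> ?flat y)"
  proof (rule ball_cong[OF refl])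
    fix y assume y: "y \<in> sphere_at E 1 x"
    have y1: "level 1 (vertex y)" using level_vertex[of y] y by (simp add: sphere_at_def)
    then have 0: "level 0 (lower (vertex y))" using at_level_lower[of E x 0] by simp
    have lev: "level (Suc m) (raise m (vertex y))" for m
      using at_level_raise_power[OF y1, of m] by simp
    have "level (Suc j) (raise (Suc j) (lower (vertex y)))"
      using at_level_raise_power[OF 0, of "Suc j"] by simp
    then have "lower (raise (Suc j) (vertex y)) $ z = 0 \<and> flat (raise j (vertex y)) $ z = 0
        \<and> raise j (vertex y) $ z = 0 \<and> raise (Suc j) (lower (vertex y)) $ z = 0"
      if "gdist E x z \<noteq> Suc j" for z
      using that lev at_level_lower[OF lev] at_level_flat[OF lev] unfolding at_level_def by blast
    then show "(\<forall>z. gdist E x z = Suc j \<longrightarrow> holds y z) \<longleftrightarrow> ?lower y \<and> ?flat y"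
      unfolding holds_def walks_rl_raise walks_rf_raise walks_r_raise walks_lr_raise vec_eq_iff
        vector_add_component vector_smult_component
      by (metis add_0 mult_zero_right)
  qed
  finally show ?thesis .
qed

lemma level_1_induct [consumes 1, case_names vertex zero add scale]:
  assumes "level 1 v"
    and "\<And>y. y \<in> sphere_at E 1 x \<Longrightarrow> P (vertex y)" "P 0"
    and "\<And>u w. P u \<Longrightarrow> P w \<Longrightarrow> P (u + w)" "\<And>c u. P u \<Longrightarrow> P (c *s u)"
  shows "P v"
proof -
  have "v = (\<Sum>y\<in>sphere_at E 1 x. v $ y *s vertex y)"
  proof (subst vec_eq_iff, intro allI)
    fix z
    have "(\<Sum>y\<in>sphere_at E 1 x. v $ y *s vertex y) $ z = (\<Sum>y\<in>sphere_at E 1 x. if z = y then v $ z else 0)"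
      unfolding sum_component vector_smult_component by (rule sum.cong) (auto simp: axis_def)
    with assms(1) show "v $ z = (\<Sum>y\<in>sphere_at E 1 x. v $ y *s vertex y) $ z"
      by (auto simp: at_level_def sphere_at_def)
  qed
  moreover have "P (\<Sum>y\<in>S. v $ y *s vertex y)" if "S \<subseteq> sphere_at E 1 x" for S
    using finite[of S] that by (induction S) (simp_all add: assms(2-))
  ultimately show ?thesis by (metis order_refl)
qed

text \<open>
  By linearity the operator identities pass from the neighbours of \<open>x\<close> to all vectors on level 1; on
  those annihilated by \<open>L\<close>, the terms with \<open>\<mu>\<close> and \<open>\<rho>\<close> disappear.
\<close>

lemma walk_conditions_imp_ladder:
  assumes "\<And>i. i \<in> {1..ecc} \<Longrightarrow> \<exists>\<kappa> \<mu> \<theta> \<rho>. walk_conditions E x i \<kappa> \<mu> \<theta> \<rho>"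
  obtains \<kappa> \<theta> where "\<And>v. level 1 v \<Longrightarrow> lower v = 0 \<Longrightarrow> ladder \<kappa> \<theta> v"
proof -
  have "\<exists>k t. \<forall>v. level 1 v \<and> lower v = 0 \<longrightarrow>
      lower (raise (Suc j) v) = k *s raise j v \<and> flat (raise j v) = t *s raise j v" for j
  proof (cases "Suc j \<le> ecc")
    case True
    then obtain \<kappa> \<mu> \<theta> \<rho> where "walk_conditions E x (Suc j) \<kappa> \<mu> \<theta> \<rho>" using assms[of "Suc j"] by auto
    note wc = this[unfolded walk_conditions_iff, rule_format]
    have "lower (raise (Suc j) v) = \<kappa> *s raise j v + \<mu> *s raise (Suc j) (lower v) \<and>
        flat (raise j v) = \<theta> *s raise j v + \<rho> *s raise (Suc j) (lower v)" if "level 1 v" for v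
      using that
    proof (induction rule: level_1_induct)
      case (vertex y)
      then show ?case by (rule wc)
    qed (simp_all add: vec.add vec.scale vec.scale_right_distrib vec.scale_left_commute algebra_simps)
    then show ?thesis by (intro exI[of _ \<kappa>] exI[of _ \<theta>]) simp
  next
    case False
    then have "raise j v = 0" if "level 1 v" for v
      using at_level_raise_power[OF that, of j] at_level_imp_zero[of E x "Suc j"] by simp
    then show ?thesis by (simp add: raise_power_Suc)
  qed
  then obtain \<kappa> \<theta> where "\<And>j v. level 1 v \<and> lower v = 0 \<longrightarrow>
      lower (raise (Suc j) v) = \<kappa> j *s raise j v \<and> flat (raise j v) = \<theta> j *s raise j v" by metis
  with that show thesis unfolding ladder_def by blast
qed

section \<open>The primary module\<close>

lemma raise_rise: "raise m (step_matrix E x Rise *v v) = raise (Suc m) v"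
  by (simp add: raise_power_def matrix_vector_mul_assoc)

lemma root_level: "level 0 (vertex x)"
  using level_vertex[of x] by (simp add: gdist_self)

text \<open>
  By thinness, the level \<open>i\<close> of the primary module is spanned by \<open>R\<^sup>i x\<close>, which is nonzero up to the
  eccentricity because even \<open>R\<^sup>d x\<close> has a nonzero coordinate.
\<close>

lemma primary_level_proportional:
  assumes "thin E x (primary_module E x)" "p \<in> primary_module E x" "level i p"
  obtains c where "p = c *s raise i (vertex x)"
proof (cases "i \<le> ecc")
  case True
  have "ecc \<in> {gdist E x z | z. True}"
    unfolding eccentricity_def by (rule Max_in) (auto simp: full_SetCompr_eq)
  then obtain z where z: "gdist E x z = ecc" by auto
  have "raise i (vertex x) \<noteq> 0"
  proof
    assume 0: "raise i (vertex x) = 0"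
    have "raise (i + m) (vertex x) = 0" for m
      by (induction m) (simp_all add: 0 raise_power_Suc)
    from this[of "ecc - i"] True raise_vertex_root_nonzero[of z] show False by (simp add: z)
  qed
  moreover have "level i (raise i (vertex x))" using at_level_raise_power[OF root_level, of i] by simp
  ultimately show thesis
    using thin_proportional[OF t_module_primary assms(1)
        t_module_raise[OF t_module_primary axis_mem_primary] _ _ assms(2,3)] that by blast
next
  case False
  then have "p = 0 *s raise i (vertex x)" using at_level_imp_zero[OF assms(3)] by simp
  then show thesis by (rule that)
qed

lemma rise_root: "step_matrix E x Rise *v vertex x = (\<Sum>y\<in>sphere_at E 1 x. vertex y)"
proof -
  have "(\<Sum>y\<in>sphere_at E 1 x. vertex y) $ z = (\<Sum>y\<in>sphere_at E 1 x. if z = y then 1 else 0)" for z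
    unfolding sum_component by (rule sum.cong) (auto simp: axis_def)
  then show ?thesis using gdist_eq_1_imp_edge
    by (auto simp: vec_eq_iff step_matrix_vertex sphere_at_def gdist_self)
qed

lemma lower_rise_root:
  "lower (step_matrix E x Rise *v vertex x) = of_nat (card (sphere_at E 1 x)) *s vertex x"
proof -
  have "lower (step_matrix E x Rise *v vertex x) = (\<Sum>y\<in>sphere_at E 1 x. vertex x)"
    unfolding rise_root vec.sum by (rule sum.cong) (simp_all add: lower_vertex)
  also have "\<dots> = of_nat (card (sphere_at E 1 x)) *s vertex x"
    by (simp only: vec_eq_iff sum_component) simp
  finally show ?thesis .
qed

text \<open>
  With \<open>k = card (\<Gamma>(x))\<close>, subtracting the average of all neighbours turns a neighbour \<open>y\<close> of \<open>x\<close> into a vector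
  \<open>u = y - s\<^sub>1 / k\<close> with \<open>L u = 0\<close>, to which the ladder equations apply.  What they leave over for \<open>y\<close> is a
  multiple of \<open>s\<^bsub>j+1\<^esub>\<close>, because \<open>L s\<^bsub>j+2\<^esub> = \<alpha> s\<^bsub>j+1\<^esub>\<close> and \<open>F s\<^bsub>j+1\<^esub> = \<beta> s\<^bsub>j+1\<^esub>\<close> in the thin primary
  module.  Solving for the coefficients gives \<open>\<mu> = (\<alpha> - \<kappa>\<^sub>j) / k\<close> and \<open>\<rho> = (\<beta> - \<theta>\<^sub>j) / k\<close>.
\<close>

lemma ladder_imp_walk_conditions:
  assumes thin: "thin E x (primary_module E x)" and k: "card (sphere_at E 1 x) > 0"
    and lad: "\<And>v. level 1 v \<Longrightarrow> lower v = 0 \<Longrightarrow> ladder \<kappa> \<theta> v"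
  shows "\<exists>\<mu> \<rho>. walk_conditions E x (Suc j) (\<kappa> j) \<mu> (\<theta> j) \<rho>"
proof -
  let ?k = "of_nat (card (sphere_at E 1 x)) :: complex"
  let ?s = "\<lambda>m. raise m (vertex x)"
  have mem: "?s m \<in> primary_module E x" for m
    by (rule t_module_raise[OF t_module_primary axis_mem_primary])
  have step: "step_matrix E x t *v ?s m \<in> primary_module E x" for t m
    using mem t_module_mult[OF t_module_primary] step_matrix_in_terwilliger by blast
  have lev: "level m (?s m)" for m using at_level_raise_power[OF root_level, of m] by simp
  obtain \<alpha> where \<alpha>: "lower (?s (Suc (Suc j))) = \<alpha> *s ?s (Suc j)"
    by (rule primary_level_proportional[OF thin step at_level_lower[OF lev]])
  obtain \<beta> where \<beta>: "flat (?s (Suc j)) = \<beta> *s ?s (Suc j)"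
    by (rule primary_level_proportional[OF thin step at_level_flat[OF lev]])
  have "lower (raise (Suc j) (vertex y)) = \<kappa> j *s raise j (vertex y) + ((\<alpha> - \<kappa> j) / ?k) *s ?s (Suc j) \<and>
      flat (raise j (vertex y)) = \<theta> j *s raise j (vertex y) + ((\<beta> - \<theta> j) / ?k) *s ?s (Suc j)"
    if y: "y \<in> sphere_at E 1 x" for y
  proof -
    define u where "u = vertex y - (1 / ?k) *s (step_matrix E x Rise *v vertex x)"
    have "level 1 (vertex y)" using level_vertex[of y] y by (simp add: sphere_at_def)
    moreover have "level 1 (step_matrix E x Rise *v vertex x)" using at_level_rise[OF root_level] by simp
    ultimately have "level 1 u" unfolding u_def by (intro at_level_diff at_level_scale)
    moreover have "lower u = 0"
      using k by (simp add: card_gt_0_iff u_def vec.diff vec.scale lower_vertex[OF y] lower_rise_root)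
    ultimately have "ladder \<kappa> \<theta> u" by (rule lad)
    then have u: "lower (raise (Suc j) u) = \<kappa> j *s raise j u" "flat (raise j u) = \<theta> j *s raise j u"
      by (auto simp: ladder_def)
    have ru: "raise m u = raise m (vertex y) - (1 / ?k) *s ?s (Suc m)" for m
      by (simp add: u_def vec.diff vec.scale raise_rise)
    have solve: "p = a *s q + ((b - a) / ?k) *s s"
      if "p - (1 / ?k) *s (b *s s) = a *s (q - (1 / ?k) *s s)" for p q s :: "complex^'a" and a b
    proof -
      have "p = a *s (q - (1 / ?k) *s s) + (1 / ?k) *s (b *s s)" using that by (simp add: diff_eq_eq)
      then show ?thesis by (simp add: vec_eq_iff algebra_simps diff_divide_distrib)
    qed
    show ?thesis
      using u unfolding ru vec.diff vec.scale \<alpha> \<beta> by (intro conjI solve)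
  qed
  then have "walk_conditions E x (Suc j) (\<kappa> j) ((\<alpha> - \<kappa> j) / ?k) (\<theta> j) ((\<beta> - \<theta> j) / ?k)"
    unfolding walk_conditions_iff by (simp add: lower_vertex)
  then show ?thesis by blast
qed

text \<open>
  By thinness the primary module meets level 1 only in the line through \<open>R x\<close>, and \<open>u\<close> is orthogonal to
  it because \<open>L\<close> is the adjoint of \<open>R\<close>.  So \<open>u\<close>, and with it \<open>T u\<close>, is orthogonal to the
  primary module, in particular to \<open>x\<close>.
\<close>

lemma cyclic_proj_0:
  assumes thin: "thin E x (primary_module E x)" and u: "level 1 u" "lower u = 0" and b: "b \<in> cyclic u"
  shows "proj 0 b = 0"
proof -
  have adj: "adjoint_matrix (step_matrix E x Lower) = step_matrix E x Rise"
    using sym by (auto simp: vec_eq_iff step_matrix_def symp_def)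
  have "u \<bullet> p = 0" if p: "p \<in> primary_module E x" for p
  proof -
    obtain c where c: "proj 1 p = c *s raise 1 (vertex x)"
      by (rule primary_level_proportional[OF thin t_module_proj[OF t_module_primary p] at_level_dual_idempotent])
    have "u \<bullet> p = proj 1 u \<bullet> p" using dual_idempotent_level[OF u(1), of 1] by simp
    also have "\<dots> = u \<bullet> raise 1 (c *s vertex x)" by (simp only: inner_dual_idempotent c vec.scale)
    also have "\<dots> = lower u \<bullet> (c *s vertex x)"
      by (simp add: inner_adjoint adj raise_power_Suc)
    finally show ?thesis using u(2) by simp
  qed
  then have *: "b \<bullet> p = 0" if "p \<in> primary_module E x" for p
    using cyclic_orthogonal[OF t_module_primary _ b that] by blast
  have "proj 0 b \<in> primary_module E x"
    unfolding dual_idempotent_0_mult[OF conn]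
    using t_module_subspace[OF t_module_primary] axis_mem_primary by (rule vec.subspace_scale)
  then have "proj 0 b \<bullet> proj 0 b = 0"
    using *[of "proj 0 b"] dual_idempotent_level[OF at_level_dual_idempotent[of E x 0 b], of 0]
    by (simp only: inner_dual_idempotent) simp
  then show ?thesis by simp
qed

section \<open>Thinness and uniqueness\<close>

text \<open>
  All vectors on level 1 of irreducible modules with endpoint 1 are ladders with the scalars found in
  the given one.  The ladders with these scalars form a subspace \<open>S\<close>; a vector with \<open>L v = 0\<close> on level
  1 that is orthogonal to \<open>S\<close> must vanish, since otherwise it generates a module that contains an
  irreducible one with endpoint 1 and hence a nonzero ladder in \<open>S\<close> that is orthogonal to \<open>S\<close>.
\<close>

lemma unique_thin_imp_ladder:
  assumes thin: "thin E x (primary_module E x)"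
    and W: "irreducible_t_module E x W" "endpoint E x W = 1" "thin E x W"
    and uniq: "\<And>W'. irreducible_t_module E x W' \<Longrightarrow> endpoint E x W' = 1 \<Longrightarrow> t_isomorphic E x W W'"
  obtains \<kappa> \<theta> where "\<And>v. level 1 v \<Longrightarrow> lower v = 0 \<Longrightarrow> ladder \<kappa> \<theta> v"
proof -
  have mod: "t_module E x W" using W(1) by (simp add: irreducible_t_module_def)
  obtain w where w: "w \<in> W" "w \<noteq> 0" "level 1 w" "lower w = 0" using endpoint_1_vector[OF W(1,2)] .
  obtain \<kappa> \<theta> where lad: "ladder \<kappa> \<theta> w" using thin_vector_is_ladder[OF mod W(3) w(1,3,4)] .
  let ?S = "{v. ladder \<kappa> \<theta> v}"
  have zero: "u = 0" if u: "level 1 u" "lower u = 0" and orth: "\<And>s. s \<in> ?S \<Longrightarrow> u \<bullet> s = 0" for u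
  proof (rule ccontr)
    assume "u \<noteq> 0"
    have u1: "proj 1 u = u" using dual_idempotent_level[OF u(1), of 1] by simp
    obtain W' where W': "W' \<subseteq> cyclic u" "irreducible_t_module E x W'" "endpoint E x W' = 1"
      by (rule exists_irreducible_endpoint_1[OF t_module_cyclic cyclic_proj_0[OF thin u]
            generator_in_cyclic]) (use u1 \<open>u \<noteq> 0\<close> in auto)
    obtain w' where w': "w' \<in> W'" "w' \<noteq> 0" "level 1 w'" "lower w' = 0"
      using endpoint_1_vector[OF W'(2,3)] .
    have lad': "ladder \<kappa> \<theta> w'"
      by (rule isomorphic_vector_is_ladder[OF uniq[OF W'(2,3)] mod W(3) w(1,2) lad w'(1,3)])
    obtain B where B: "B \<in> T" "w' = B *v u" using w'(1) W'(1) by (auto simp: cyclic_def)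
    obtain c where c: "\<And>v. ladder \<kappa> \<theta> v \<Longrightarrow> proj (Suc 0) (adjoint_matrix B *v v) = c *s raise 0 v"
      using ladder_compression[OF adjoint_terwilliger[OF sym B(1)]] by blast
    \<comment> \<open>Elements of \<open>T\<close>, cut down to level 1, preserve each line of \<open>S\<close>; so \<open>w' = B u\<close> is orthogonal to \<open>S\<close> like \<open>u\<close>.\<close>
    have "w' \<bullet> w' = proj 1 u \<bullet> (adjoint_matrix B *v w')"
      by (simp only: u1 B(2) inner_adjoint)
    also have "\<dots> = u \<bullet> (c *s w')"
      unfolding inner_dual_idempotent using c[OF lad'] by simp
    also have "\<dots> = 0" using ladder_scale[OF lad'] by (intro orth) simp
    finally show False using w'(2) by simp
  qed
  have decomp: "\<exists>s u. s \<in> ?S \<and> (\<forall>r\<in>?S. u \<bullet> r = 0) \<and> v = s + u" for v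
  proof -
    have "r *\<^sub>R a = complex_of_real r *s a" for r and a :: "complex^'a"
      unfolding vec_eq_iff vector_scaleR_component vector_smult_component
      by (simp add: scaleR_conv_of_real)
    then have "subspace ?S" using ladder_zero ladder_add ladder_scale by (simp add: subspace_def)
    then have span: "span ?S = ?S" by (simp add: span_eq_iff)
    obtain s u where "s \<in> span ?S" "\<And>r. r \<in> span ?S \<Longrightarrow> orthogonal u r" "v = s + u"
      by (rule orthogonal_subspace_decomp_exists[of ?S v]) blast
    then show ?thesis unfolding span orthogonal_def by blast
  qed
  have "ladder \<kappa> \<theta> v" if v: "level 1 v" "lower v = 0" for v
  proof -
    obtain s u where su: "s \<in> ?S" "\<forall>r\<in>?S. u \<bullet> r = 0" "v = s + u"
      using decomp by blast
    then have "u = v - s" by simp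
    with su(1) v have "level 1 u" "lower u = 0"
      by (auto simp: ladder_def vec.diff intro: at_level_diff)
    then have "u = 0" using su(2) zero by blast
    with su show ?thesis by simp
  qed
  then show thesis by (rule that)
qed

text \<open>
  Two distinct neighbours of \<open>x\<close> provide a nonzero vector \<open>y - z\<close> annihilated by \<open>L\<close>.
\<close>

lemma ladder_imp_unique_thin:
  assumes card: "card (sphere_at E 1 x) \<ge> 2"
    and lad: "\<And>v. level 1 v \<Longrightarrow> lower v = 0 \<Longrightarrow> ladder \<kappa> \<theta> v"
  obtains W where "irreducible_t_module E x W" "endpoint E x W = 1" "thin E x W"
    "\<And>W'. irreducible_t_module E x W' \<Longrightarrow> endpoint E x W' = 1 \<Longrightarrow> t_isomorphic E x W W'"
proof -
  obtain y z where yz: "y \<in> sphere_at E 1 x" "z \<in> sphere_at E 1 x" "y \<noteq> z"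
    using card_le_Suc0_iff_eq[of "sphere_at E 1 x"] card by fastforce
  define v where "v = vertex y - vertex z"
  have "level 1 v"
    using level_vertex[of y] level_vertex[of z] yz by (simp add: v_def sphere_at_def at_level_diff)
  moreover have "lower v = 0" using yz by (simp add: v_def vec.diff lower_vertex)
  ultimately have v: "ladder \<kappa> \<theta> v" by (rule lad)
  have "v $ y \<noteq> 0" using yz(3) by (simp add: v_def axis_def)
  then have v0: "v \<noteq> 0" by auto
  have "t_isomorphic E x (cyclic v) W'" if W': "irreducible_t_module E x W'" "endpoint E x W' = 1" for W'
  proof -
    obtain w where w: "w \<in> W'" "w \<noteq> 0" "level 1 w" "lower w = 0"
      using endpoint_1_vector[OF W'] .
    have mod: "t_module E x W'" using W'(1) by (simp add: irreducible_t_module_def)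
    have "cyclic w = W'"
      using W'(1) t_module_cyclic[of w] cyclic_subset[OF mod w(1)] generator_in_cyclic[of w] w(2)
      unfolding irreducible_t_module_def by blast
    then show ?thesis using cyclic_ladder_isomorphic[OF v v0 lad[OF w(3,4)] w(2)] by simp
  qed
  then show thesis
    using that irreducible_cyclic_ladder[OF v v0] endpoint_cyclic_ladder[OF v v0] thin_cyclic_ladder[OF v]
    by blast
qed

lemma walk_conditions_far_imp_zero:
  assumes wc: "walk_conditions E x i \<kappa> \<mu> \<theta> \<rho>" and i: "i \<ge> 1"
    and y: "y \<in> sphere_at E 1 x" and z: "z \<in> dist_set E i (i + 1) x y"
  shows "\<rho> = 0"
proof -
  have dist: "gdist E x z = i" "gdist E y z = i + 1" using z by (auto simp: dist_set_def sphere_at_def)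
  have "num_walks E x (replicate (i - 1) Rise @ [Flat]) y z = 0"
  proof (rule ccontr)
    assume "num_walks E x (replicate (i - 1) Rise @ [Flat]) y z \<noteq> 0"
    from gdist_le_num_walks[OF this] dist(2) i show False by simp
  qed
  then have "walks_rf E x (i - 1) y z = 0" by (simp only: walks_rf_def of_nat_0)
  moreover have "walks_rf E x (i - 1) y z = \<rho> * walks_lr E x i y z"
    using wc y z unfolding walk_conditions_def by blast
  moreover have "walks_lr E x i y z \<noteq> 0"
    using raise_vertex_root_nonzero[of z] unfolding walks_lr_raise lower_vertex[OF y] dist .
  ultimately show ?thesis by simp
qed

end

theorem theorem3p5:
  fixes E :: "'a::finite \<Rightarrow> 'a \<Rightarrow> bool" and x :: 'a
  assumes "symp E" and "irreflp E" and "\<And>u v. E\<^sup>*\<^sup>* u v"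
    and "card (sphere_at E 1 x) \<ge> 2"
    and "thin E x (primary_module E x)"
  shows
    "((\<exists>W. irreducible_t_module E x W \<and> endpoint E x W = 1 \<and> thin E x W \<and>
         (\<forall>W'. irreducible_t_module E x W' \<and> endpoint E x W' = 1 \<longrightarrow> t_isomorphic E x W W'))
      \<longleftrightarrow>
      (\<forall>i\<in>{1..eccentricity E x}. \<exists>\<kappa> \<mu> \<theta> \<rho>. walk_conditions E x i \<kappa> \<mu> \<theta> \<rho>))
     \<and>
     (\<forall>i\<in>{1..eccentricity E x}. \<forall>\<kappa> \<mu> \<theta> \<rho>.
        walk_conditions E x i \<kappa> \<mu> \<theta> \<rho> \<and> (\<exists>y\<in>sphere_at E 1 x. dist_set E i (i + 1) x y \<noteq> {})
        \<longrightarrow> \<rho> = 0)"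
proof -
  interpret rooted_graph E x
    by unfold_locales (rule assms(1), rule assms(3))
  show ?thesis
  proof (intro conjI iffI ballI allI impI)
    fix i
    assume "\<exists>W. irreducible_t_module E x W \<and> endpoint E x W = 1 \<and> thin E x W \<and>
         (\<forall>W'. irreducible_t_module E x W' \<and> endpoint E x W' = 1 \<longrightarrow> t_isomorphic E x W W')"
      and i: "i \<in> {1..ecc}"
    then obtain W where W: "irreducible_t_module E x W" "endpoint E x W = 1" "thin E x W"
      "\<And>W'. irreducible_t_module E x W' \<Longrightarrow> endpoint E x W' = 1 \<Longrightarrow> t_isomorphic E x W W'" by blast
    obtain \<kappa> \<theta> where lad: "\<And>v. level 1 v \<Longrightarrow> lower v = 0 \<Longrightarrow> ladder \<kappa> \<theta> v"
      by (rule unique_thin_imp_ladder[OF assms(5) W]) blast+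
    obtain j where j: "i = Suc j" using i by (cases i) auto
    have "card (sphere_at E 1 x) > 0" using assms(4) by simp
    then show "\<exists>\<kappa> \<mu> \<theta> \<rho>. walk_conditions E x i \<kappa> \<mu> \<theta> \<rho>"
      using ladder_imp_walk_conditions[OF assms(5) _ lad, of j] unfolding j by blast
  next
    assume "\<forall>i\<in>{1..ecc}. \<exists>\<kappa> \<mu> \<theta> \<rho>. walk_conditions E x i \<kappa> \<mu> \<theta> \<rho>"
    then have wc: "\<exists>\<kappa> \<mu> \<theta> \<rho>. walk_conditions E x i \<kappa> \<mu> \<theta> \<rho>" if "i \<in> {1..ecc}" for i
      using that by blast
    obtain \<kappa> \<theta> where lad: "\<And>v. level 1 v \<Longrightarrow> lower v = 0 \<Longrightarrow> ladder \<kappa> \<theta> v"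
      by (rule walk_conditions_imp_ladder[OF wc]) blast+
    obtain W where "irreducible_t_module E x W" "endpoint E x W = 1" "thin E x W"
      "\<And>W'. irreducible_t_module E x W' \<Longrightarrow> endpoint E x W' = 1 \<Longrightarrow> t_isomorphic E x W W'"
      using ladder_imp_unique_thin[OF assms(4) lad] by blast
    then show "\<exists>W. irreducible_t_module E x W \<and> endpoint E x W = 1 \<and> thin E x W \<and>
         (\<forall>W'. irreducible_t_module E x W' \<and> endpoint E x W' = 1 \<longrightarrow> t_isomorphic E x W W')" by blast
  next
    fix i \<kappa> \<mu> \<theta> \<rho>
    assume i: "i \<in> {1..ecc}"
      and "walk_conditions E x i \<kappa> \<mu> \<theta> \<rho> \<and> (\<exists>y\<in>sphere_at E 1 x. dist_set E i (i + 1) x y \<noteq> {})"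
    then show "\<rho> = 0" using walk_conditions_far_imp_zero[of i \<kappa> \<mu> \<theta> \<rho>] by fastforce
  qed
qed

end
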